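(* Let $(M,J,g)$ be a strict nearly Kähler manifold of (real) dimension six and let $L\subset M$ be a Lagrangian submanifold. Then $L$ is orientable and minimal (i.e. its mean curvature vector vanishes identically).
   Context: An almost Hermitian manifold $(M,J,g)$ with Levi-Civita connection $\nabla$ is nearly Kähler if $(\nabla_XJ)X=0$ for all $X\in TM$. It is strict nearly Kähler if, moreover, $\nabla_XJ\neq 0$ for all $X\in TM$, $X\ne 0$. Its characteristic $2$-form is $\omega(X,Y)=g(JX,Y)$ (not closed in general). A submanifold (immersed or embedded) $L\subset M$ is Lagrangian if $\omega|_{TL}=0$ and $2\dim L=\dim M$. *)

theory Defs
  imports "HOL-Analysis.Analysis"
begin

abbreviation der ::
  "('a::real_normed_vector \<Rightarrow> 'b::real_normed_vector) \<Rightarrow> 'a \<Rightarrow> 'a \<Rightarrow> 'b" where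
  "der f x \<equiv> frechet_derivative f (at x)"

primrec Ck_on ::
  "nat \<Rightarrow> 'a::euclidean_space set \<Rightarrow> ('a \<Rightarrow> 'b::real_normed_vector) \<Rightarrow> bool" where
  "Ck_on 0 S f \<longleftrightarrow> continuous_on S f"
| "Ck_on (Suc k) S f \<longleftrightarrow>
     (\<forall>x\<in>S. f differentiable (at x)) \<and> (\<forall>v. Ck_on k S (\<lambda>x. der f x v))"

text \<open>Only used for open \<open>S\<close>.\<close>

definition smooth_on :: "'a::euclidean_space set \<Rightarrow> ('a \<Rightarrow> 'b::real_normed_vector) \<Rightarrow> bool" where
  "smooth_on S f \<longleftrightarrow> (\<forall>k. Ck_on k S f)"


section \<open>Smooth manifolds\<close>

text \<open>A chart is a pair of its domain and its coordinate map; the values of the coordinate map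
  outside the domain are irrelevant.\<close>

type_synonym ('m, 'n) chart = "'m set \<times> ('m \<Rightarrow> real ^ 'n)"

abbreviation chart_image :: "('m, 'n::finite) chart \<Rightarrow> (real ^ 'n) set" where
  "chart_image c \<equiv> snd c ` fst c"

abbreviation chart_inv :: "('m, 'n::finite) chart \<Rightarrow> real ^ 'n \<Rightarrow> 'm" where
  "chart_inv c \<equiv> inv_into (fst c) (snd c)"

definition is_chart :: "'m topology \<Rightarrow> ('m, 'n::finite) chart \<Rightarrow> bool" where
  "is_chart M c \<longleftrightarrow> openin M (fst c) \<and> open (chart_image c) \<and>
     homeomorphic_map (subtopology M (fst c)) (top_of_set (chart_image c)) (snd c)"

definition local_rep ::
  "('l, 'k::finite) chart \<Rightarrow> ('m, 'n::finite) chart \<Rightarrow> ('l \<Rightarrow> 'm) \<Rightarrow> real ^ 'k \<Rightarrow> real ^ 'n" where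
  "local_rep d c F = snd c \<circ> F \<circ> chart_inv d"

definition local_dom ::
  "('l, 'k::finite) chart \<Rightarrow> ('m, 'n::finite) chart \<Rightarrow> ('l \<Rightarrow> 'm) \<Rightarrow> (real ^ 'k) set" where
  "local_dom d c F = snd d ` (fst d \<inter> F -` fst c)"

abbreviation transition ::
  "('m, 'n::finite) chart \<Rightarrow> ('m, 'n) chart \<Rightarrow> real ^ 'n \<Rightarrow> real ^ 'n" where
  "transition c d \<equiv> local_rep c d (\<lambda>p. p)"

abbreviation overlap ::
  "('m, 'n::finite) chart \<Rightarrow> ('m, 'n) chart \<Rightarrow> (real ^ 'n) set" where
  "overlap c d \<equiv> local_dom c d (\<lambda>p. p)"

definition smooth_atlas :: "'m topology \<Rightarrow> ('m, 'n::finite) chart set \<Rightarrow> bool" where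
  "smooth_atlas M A \<longleftrightarrow> (\<forall>c\<in>A. is_chart M c) \<and> (\<Union>c\<in>A. fst c) = topspace M \<and>
     (\<forall>c\<in>A. \<forall>d\<in>A. smooth_on (overlap c d) (transition c d))"

definition smooth_manifold :: "'m topology \<Rightarrow> ('m, 'n::finite) chart set \<Rightarrow> bool" where
  "smooth_manifold M A \<longleftrightarrow> Hausdorff_space M \<and> second_countable M \<and> smooth_atlas M A"

text \<open>The atlas \<open>A\<close> need not be maximal, so an oriented atlas is only required to be compatible
  with \<open>A\<close>, that is, to define the same smooth structure.\<close>

definition orientable :: "'m topology \<Rightarrow> ('m, 'n::finite) chart set \<Rightarrow> bool" where
  "orientable M A \<longleftrightarrow> (\<exists>A' :: ('m, 'n) chart set.
     smooth_atlas M A' \<and> smooth_atlas M (A \<union> A') \<and>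
     (\<forall>c\<in>A'. \<forall>d\<in>A'. \<forall>x\<in>overlap c d. det (matrix (der (transition c d) x)) > 0))"


section \<open>Tensor fields and connections\<close>

text \<open>A tangent vector at the point with coordinates \<open>x\<close> in the chart \<open>c\<close> is given by its
  components in \<open>real ^ 'n\<close>; under a change of chart these are transformed by the derivative of the
  transition map. Tensor fields and connections are families indexed by charts: in the chart \<open>c\<close>
  a metric is \<open>g c x v w\<close>, an almost complex structure is \<open>J c x v\<close>, and a connection has the
  Christoffel form \<open>\<Gamma> c x v w\<close>, with \<open>v\<close> the direction of differentiation. Values at
  \<open>x \<notin> chart_image c\<close> are irrelevant.\<close>

type_synonym ('m, 'n) metric_tensor =
  "('m, 'n) chart \<Rightarrow> real ^ 'n \<Rightarrow> real ^ 'n \<Rightarrow> real ^ 'n \<Rightarrow> real"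
type_synonym ('m, 'n) endomorphism_field =
  "('m, 'n) chart \<Rightarrow> real ^ 'n \<Rightarrow> real ^ 'n \<Rightarrow> real ^ 'n"
type_synonym ('m, 'n) connection =
  "('m, 'n) chart \<Rightarrow> real ^ 'n \<Rightarrow> real ^ 'n \<Rightarrow> real ^ 'n \<Rightarrow> real ^ 'n"

definition riemannian_metric ::
  "('m, 'n::finite) chart set \<Rightarrow> ('m, 'n) metric_tensor \<Rightarrow> bool" where
  "riemannian_metric A g \<longleftrightarrow>
     (\<forall>c\<in>A. \<forall>v w. smooth_on (chart_image c) (\<lambda>x. g c x v w)) \<and>
     (\<forall>c\<in>A. \<forall>x\<in>chart_image c. bilinear (g c x) \<and> (\<forall>v w. g c x v w = g c x w v) \<and>
        (\<forall>v. v \<noteq> 0 \<longrightarrow> g c x v v > 0)) \<and>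
     (\<forall>c\<in>A. \<forall>d\<in>A. \<forall>x\<in>overlap c d. \<forall>v w.
        g d (transition c d x) (der (transition c d) x v) (der (transition c d) x w) = g c x v w)"

definition almost_complex_structure ::
  "('m, 'n::finite) chart set \<Rightarrow> ('m, 'n) endomorphism_field \<Rightarrow> bool" where
  "almost_complex_structure A J \<longleftrightarrow>
     (\<forall>c\<in>A. \<forall>v. smooth_on (chart_image c) (\<lambda>x. J c x v)) \<and>
     (\<forall>c\<in>A. \<forall>x\<in>chart_image c. linear (J c x) \<and> (\<forall>v. J c x (J c x v) = - v)) \<and>
     (\<forall>c\<in>A. \<forall>d\<in>A. \<forall>x\<in>overlap c d. \<forall>v.
        J d (transition c d x) (der (transition c d) x v) = der (transition c d) x (J c x v))"

definition almost_hermitian ::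
  "('m, 'n::finite) chart set \<Rightarrow> ('m, 'n) endomorphism_field \<Rightarrow> ('m, 'n) metric_tensor \<Rightarrow> bool" where
  "almost_hermitian A J g \<longleftrightarrow> riemannian_metric A g \<and> almost_complex_structure A J \<and>
     (\<forall>c\<in>A. \<forall>x\<in>chart_image c. \<forall>v w. g c x (J c x v) (J c x w) = g c x v w)"

text \<open>The covariant derivative, in direction \<open>u\<close> at \<open>x\<close>, of a vector field \<open>W\<close> along a map \<open>f\<close> into
  a coordinate domain with Christoffel form \<open>\<Gamma>\<close> (that is, the pull-back connection).\<close>

definition cov_along ::
  "(real ^ 'n \<Rightarrow> real ^ 'n \<Rightarrow> real ^ 'n \<Rightarrow> real ^ 'n) \<Rightarrow> (real ^ 'k \<Rightarrow> real ^ 'n) \<Rightarrow>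
   real ^ 'k \<Rightarrow> real ^ 'k \<Rightarrow> (real ^ 'k \<Rightarrow> real ^ 'n) \<Rightarrow> real ^ 'n::finite" where
  "cov_along \<Gamma> f x u W = der W x u + \<Gamma> (f x) (der f x u) (W x)"

definition cov ::
  "(real ^ 'n \<Rightarrow> real ^ 'n \<Rightarrow> real ^ 'n \<Rightarrow> real ^ 'n) \<Rightarrow>
   real ^ 'n \<Rightarrow> real ^ 'n \<Rightarrow> (real ^ 'n \<Rightarrow> real ^ 'n) \<Rightarrow> real ^ 'n::finite" where
  "cov \<Gamma> x v W = der W x v + \<Gamma> x v (W x)"

definition lie_bracket ::
  "(real ^ 'n \<Rightarrow> real ^ 'n) \<Rightarrow> (real ^ 'n \<Rightarrow> real ^ 'n) \<Rightarrow> real ^ 'n \<Rightarrow> real ^ 'n::finite" where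
  "lie_bracket V W x = der W x (V x) - der V x (W x)"

text \<open>The last clause is the change-of-chart rule for Christoffel symbols. It says that \<open>cov\<close> does
  not depend on the chart.\<close>

definition affine_connection ::
  "('m, 'n::finite) chart set \<Rightarrow> ('m, 'n) connection \<Rightarrow> bool" where
  "affine_connection A \<Gamma> \<longleftrightarrow>
     (\<forall>c\<in>A. \<forall>v w. smooth_on (chart_image c) (\<lambda>x. \<Gamma> c x v w)) \<and>
     (\<forall>c\<in>A. \<forall>x\<in>chart_image c. bilinear (\<Gamma> c x)) \<and>
     (\<forall>c\<in>A. \<forall>d\<in>A. \<forall>x\<in>overlap c d. \<forall>v w.
        der (transition c d) x (\<Gamma> c x v w) =
        der (\<lambda>y. der (transition c d) y w) x v +
        \<Gamma> d (transition c d x) (der (transition c d) x v) (der (transition c d) x w))"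

definition torsion_free ::
  "('m, 'n::finite) chart set \<Rightarrow> ('m, 'n) connection \<Rightarrow> bool" where
  "torsion_free A \<Gamma> \<longleftrightarrow>
     (\<forall>c\<in>A. \<forall>V W. smooth_on (chart_image c) V \<longrightarrow> smooth_on (chart_image c) W \<longrightarrow>
        (\<forall>x\<in>chart_image c.
           cov (\<Gamma> c) x (V x) W - cov (\<Gamma> c) x (W x) V = lie_bracket V W x))"

definition metric_connection ::
  "('m, 'n::finite) chart set \<Rightarrow> ('m, 'n) metric_tensor \<Rightarrow> ('m, 'n) connection \<Rightarrow> bool" where
  "metric_connection A g \<Gamma> \<longleftrightarrow>
     (\<forall>c\<in>A. \<forall>V W. smooth_on (chart_image c) V \<longrightarrow> smooth_on (chart_image c) W \<longrightarrow>
        (\<forall>x\<in>chart_image c. \<forall>u.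
           der (\<lambda>y. g c y (V y) (W y)) x u =
           g c x (cov (\<Gamma> c) x u V) (W x) + g c x (V x) (cov (\<Gamma> c) x u W)))"

definition levi_civita ::
  "('m, 'n::finite) chart set \<Rightarrow> ('m, 'n) metric_tensor \<Rightarrow> ('m, 'n) connection \<Rightarrow> bool" where
  "levi_civita A g \<Gamma> \<longleftrightarrow>
     affine_connection A \<Gamma> \<and> torsion_free A \<Gamma> \<and> metric_connection A g \<Gamma>"


section \<open>Nearly Kaehler manifolds\<close>

text \<open>\<open>(\<nabla>\<^sub>v J) w = \<nabla>\<^sub>v (J W) - J (\<nabla>\<^sub>v W)\<close>. This is tensorial in \<open>W\<close>, so the tangent vector \<open>w\<close> may be
  extended to the coordinate field \<open>W\<close> with constant components.\<close>

definition cov_J ::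
  "('m, 'n::finite) connection \<Rightarrow> ('m, 'n) endomorphism_field \<Rightarrow>
   ('m, 'n) chart \<Rightarrow> real ^ 'n \<Rightarrow> real ^ 'n \<Rightarrow> real ^ 'n \<Rightarrow> real ^ 'n" where
  "cov_J \<Gamma> J c x v w =
     cov (\<Gamma> c) x v (\<lambda>y. J c y w) - J c x (cov (\<Gamma> c) x v (\<lambda>y. w))"

definition nearly_kaehler ::
  "('m, 'n::finite) chart set \<Rightarrow> ('m, 'n) endomorphism_field \<Rightarrow> ('m, 'n) metric_tensor \<Rightarrow>
   ('m, 'n) connection \<Rightarrow> bool" where
  "nearly_kaehler A J g \<Gamma> \<longleftrightarrow> almost_hermitian A J g \<and> levi_civita A g \<Gamma> \<and>
     (\<forall>c\<in>A. \<forall>x\<in>chart_image c. \<forall>v. cov_J \<Gamma> J c x v v = 0)"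

definition strict_nearly_kaehler ::
  "('m, 'n::finite) chart set \<Rightarrow> ('m, 'n) endomorphism_field \<Rightarrow> ('m, 'n) metric_tensor \<Rightarrow>
   ('m, 'n) connection \<Rightarrow> bool" where
  "strict_nearly_kaehler A J g \<Gamma> \<longleftrightarrow> nearly_kaehler A J g \<Gamma> \<and>
     (\<forall>c\<in>A. \<forall>x\<in>chart_image c. \<forall>v. v \<noteq> 0 \<longrightarrow> (\<exists>w. cov_J \<Gamma> J c x v w \<noteq> 0))"

definition characteristic_form ::
  "('m, 'n::finite) endomorphism_field \<Rightarrow> ('m, 'n) metric_tensor \<Rightarrow> ('m, 'n) metric_tensor" where
  "characteristic_form J g c x v w = g c x (J c x v) w"


section \<open>Submanifolds\<close>

text \<open>Submanifolds are given by smooth immersions \<open>F\<close> of a manifold \<open>L\<close>, which need not be injective;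
  an embedded submanifold is the case in which \<open>F\<close> is an inclusion.\<close>

definition smooth_map ::
  "'l topology \<Rightarrow> ('l, 'k::finite) chart set \<Rightarrow> 'm topology \<Rightarrow> ('m, 'n::finite) chart set \<Rightarrow>
   ('l \<Rightarrow> 'm) \<Rightarrow> bool" where
  "smooth_map L B M A F \<longleftrightarrow> continuous_map L M F \<and>
     (\<forall>d\<in>B. \<forall>c\<in>A. smooth_on (local_dom d c F) (local_rep d c F))"

definition immersion ::
  "'l topology \<Rightarrow> ('l, 'k::finite) chart set \<Rightarrow> 'm topology \<Rightarrow> ('m, 'n::finite) chart set \<Rightarrow>
   ('l \<Rightarrow> 'm) \<Rightarrow> bool" where
  "immersion L B M A F \<longleftrightarrow> smooth_map L B M A F \<and>
     (\<forall>d\<in>B. \<forall>c\<in>A. \<forall>x\<in>local_dom d c F. inj (der (local_rep d c F) x))"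

definition lagrangian ::
  "'l topology \<Rightarrow> ('l, 'k::finite) chart set \<Rightarrow> 'm topology \<Rightarrow> ('m, 'n::finite) chart set \<Rightarrow>
   ('m, 'n) endomorphism_field \<Rightarrow> ('m, 'n) metric_tensor \<Rightarrow> ('l \<Rightarrow> 'm) \<Rightarrow> bool" where
  "lagrangian L B M A J g F \<longleftrightarrow> immersion L B M A F \<and> 2 * CARD('k) = CARD('n) \<and>
     (\<forall>d\<in>B. \<forall>c\<in>A. \<forall>x\<in>local_dom d c F. \<forall>u v.
        characteristic_form J g c (local_rep d c F x)
          (der (local_rep d c F) x u) (der (local_rep d c F) x v) = 0)"

text \<open>The component of \<open>w\<close> orthogonal to the subspace \<open>S\<close> with respect to the inner product \<open>G\<close>.\<close>

definition normal_part ::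
  "(real ^ 'n \<Rightarrow> real ^ 'n \<Rightarrow> real) \<Rightarrow> (real ^ 'n) set \<Rightarrow> real ^ 'n \<Rightarrow> real ^ 'n::finite" where
  "normal_part G S w = (THE n. w - n \<in> S \<and> (\<forall>s\<in>S. G n s = 0))"

text \<open>The normal part of \<open>\<nabla>\<^sub>u (dF V)\<close>. This is tensorial in \<open>V\<close>, so the tangent vector \<open>v\<close> of \<open>L\<close> may be
  extended with constant components.\<close>

definition second_fundamental_form ::
  "('m, 'n::finite) metric_tensor \<Rightarrow> ('m, 'n) connection \<Rightarrow> ('l \<Rightarrow> 'm) \<Rightarrow>
   ('l, 'k::finite) chart \<Rightarrow> ('m, 'n) chart \<Rightarrow> real ^ 'k \<Rightarrow> real ^ 'k \<Rightarrow> real ^ 'k \<Rightarrow> real ^ 'n" where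
  "second_fundamental_form g \<Gamma> F d c x u v =
     (let f = local_rep d c F in
      normal_part (g c (f x)) (range (der f x)) (cov_along (\<Gamma> c) f x u (\<lambda>y. der f y v)))"

definition induced_gram ::
  "('m, 'n::finite) metric_tensor \<Rightarrow> ('l \<Rightarrow> 'm) \<Rightarrow>
   ('l, 'k::finite) chart \<Rightarrow> ('m, 'n) chart \<Rightarrow> real ^ 'k \<Rightarrow> real ^ 'k ^ 'k" where
  "induced_gram g F d c x =
     (let f = local_rep d c F in
      \<chi> i j. g c (f x) (der f x (axis i 1)) (der f x (axis j 1)))"

text \<open>The trace of the second fundamental form with respect to the induced metric, divided by the
  dimension of \<open>L\<close>.\<close>

definition mean_curvature ::
  "('m, 'n::finite) metric_tensor \<Rightarrow> ('m, 'n) connection \<Rightarrow> ('l \<Rightarrow> 'm) \<Rightarrow>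
   ('l, 'k::finite) chart \<Rightarrow> ('m, 'n) chart \<Rightarrow> real ^ 'k \<Rightarrow> real ^ 'n" where
  "mean_curvature g \<Gamma> F d c x =
     (1 / real CARD('k)) *\<^sub>R
     (\<Sum>i\<in>UNIV. \<Sum>j\<in>UNIV. matrix_inv (induced_gram g F d c x) $ i $ j *\<^sub>R
        second_fundamental_form g \<Gamma> F d c x (axis i 1) (axis j 1))"

definition minimal ::
  "('l, 'k::finite) chart set \<Rightarrow> ('m, 'n::finite) chart set \<Rightarrow> ('m, 'n) metric_tensor \<Rightarrow>
   ('m, 'n) connection \<Rightarrow> ('l \<Rightarrow> 'm) \<Rightarrow> bool" where
  "minimal B A g \<Gamma> F \<longleftrightarrow>
     (\<forall>d\<in>B. \<forall>c\<in>A. \<forall>x\<in>local_dom d c F. mean_curvature g \<Gamma> F d c x = 0)"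

end

theory Submission
  imports Defs
begin

text \<open>
  The form \<open>T (u, v, w) = g ((\<nabla>\<^sub>u J) v, w)\<close> is a 3-form, of type \<open>(3,0) + (0,3)\<close>, with
  \<open>d\<omega> = 3 T\<close>; hence \<open>T\<close> vanishes on a Lagrangian \<open>L\<close>. As \<open>TM = TL \<oplus> J TL\<close> and \<open>\<nabla>J\<close> has no kernel,
  the form \<open>T (u, v, J w)\<close> cannot vanish anywhere on \<open>L\<close>, and so it is a volume form.

  Let \<open>\<sigma>\<close> be the second fundamental form. Differentiating \<open>\<omega>|\<^bsub>TL\<^esub> = 0\<close> shows that
  \<open>g (J \<sigma> (u, v), w)\<close> is totally symmetric. Differentiating \<open>T|\<^bsub>TL\<^esub> = 0\<close> in direction \<open>u\<close> gives
  \<open>(\<nabla>\<^sub>u T) (e\<^sub>1, e\<^sub>2, e\<^sub>3) = (\<Sum>i. g (J \<sigma> (u, e\<^sub>i), e\<^sub>i)) T (e\<^sub>1, e\<^sub>2, J e\<^sub>3)\<close> in an orthonormal frame of \<open>L\<close>. The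
  left-hand side is zero: this follows from the Ricci identity for \<open>J\<close> together with the pair
  symmetry of the curvature tensor. Hence the trace of \<open>\<sigma>\<close> vanishes.
\<close>

section \<open>Calculus\<close>

text \<open>The hard step is \<open>(\<nabla>\<^sub>u T) (e1, e2, e3) = 0\<close>, since the nearly
  Kaehler condition says nothing directly about the derivative of T. It is computed only for u = e1;
  rotating the frame cyclically yields the other two directions. The Ricci identity is evaluated on
  arguments in which e1 or J e1 fills two of the four places: there the terms quadratic in \<nabla>J
  vanish, and comparing four such instances by pair symmetry forces the unknown X to satisfy 2X =
  -2X. In the differentiated equation only one normal component of each second derivative survives,
  the one along J of the frame vector that it replaces; this is how the trace appears. Orientability
  is stated through atlases, so a nowhere vanishing 3-form has to be turned into charts: each chart
  of L is shrunk and, where the form is negative, multiplied by -1. The image of a chart of L need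
  not lie in one ambient chart, so signs computed in different ambient charts must agree, which
  rests on \<nabla>J being a tensor.\<close>

lemma der_works: "f differentiable (at x) \<Longrightarrow> (f has_derivative der f x) (at x)"
  by (simp add: frechet_derivative_works)

lemma der_eqI: "(f has_derivative f') (at x) \<Longrightarrow> der f x = f'"
  using frechet_derivative_at by metis

lemma linear_der: "f differentiable (at x) \<Longrightarrow> linear (der f x)"
  by (rule linear_frechet_derivative)

lemma der_cong_open:
  assumes "open S" "x \<in> S" "\<And>y. y \<in> S \<Longrightarrow> f y = g y"
  shows "der f x = der g x"
proof (cases "f differentiable (at x)")
  case True
  then show ?thesis
    using frechet_derivative_transform_within_open[OF True assms(1,2)] assms(3) by metis
next
  case False
  \<comment> \<open>\<open>frechet_derivative\<close> is a choice. Without a derivative the two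
    values still agree, because both are chosen by the same predicate.\<close>
  have *: "(f has_derivative D) (at x) \<longleftrightarrow> (g has_derivative D) (at x)" for D
    using has_derivative_transform_within_open[OF _ assms(1,2)] assms(3) by metis
  show ?thesis
    unfolding frechet_derivative_def * ..
qed

lemma differentiable_cong_open:
  assumes "f differentiable (at x)" "open S" "x \<in> S" "\<And>y. y \<in> S \<Longrightarrow> f y = g y"
  shows "g differentiable (at x)"
  using assms has_derivative_transform_within_open unfolding differentiable_def by blast

lemma Ck_on_cong:
  assumes "open S" "\<And>y. y \<in> S \<Longrightarrow> f y = g y" "Ck_on k S f"
  shows "Ck_on k S g"
  using assms(2,3)
proof (induction k arbitrary: f g)
  case 0
  then show ?case
    by (metis Ck_on.simps(1) continuous_on_cong)
next
  case (Suc k)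
  have "g differentiable (at x)" if "x \<in> S" for x
    using differentiable_cong_open[OF _ \<open>open S\<close> that] Suc.prems that by auto
  moreover have "Ck_on k S (\<lambda>x. der g x v)" for v
    using Suc.IH[of "\<lambda>x. der f x v" "\<lambda>x. der g x v"] Suc.prems der_cong_open[OF \<open>open S\<close>, of _ f g]
    by auto
  ultimately show ?case by simp
qed

lemma der_scale:
  assumes "f differentiable (at (e *\<^sub>R x))"
  shows "(\<lambda>y. a *\<^sub>R f (e *\<^sub>R y)) differentiable (at x)"
    and "der (\<lambda>y. a *\<^sub>R f (e *\<^sub>R y)) x v = (a * e) *\<^sub>R der f (e *\<^sub>R x) v"
proof -
  have lin: "linear (der f (e *\<^sub>R x))" using assms by (rule linear_der)
  have "((\<lambda>y. e *\<^sub>R y) has_derivative (\<lambda>v. e *\<^sub>R v)) (at x)"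
    by (intro derivative_eq_intros) auto
  from has_derivative_compose[OF this der_works[OF assms]]
  have "((\<lambda>y. a *\<^sub>R f (e *\<^sub>R y)) has_derivative (\<lambda>v. a *\<^sub>R der f (e *\<^sub>R x) (e *\<^sub>R v))) (at x)"
    by (intro derivative_eq_intros) auto
  then have *: "((\<lambda>y. a *\<^sub>R f (e *\<^sub>R y)) has_derivative (\<lambda>v. (a * e) *\<^sub>R der f (e *\<^sub>R x) v)) (at x)"
    by (simp add: linear_cmul[OF lin])
  then show "(\<lambda>y. a *\<^sub>R f (e *\<^sub>R y)) differentiable (at x)"
    unfolding differentiable_def by blast
  show "der (\<lambda>y. a *\<^sub>R f (e *\<^sub>R y)) x v = (a * e) *\<^sub>R der f (e *\<^sub>R x) v"
    by (simp add: der_eqI[OF *])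
qed

text \<open>The outer factor \<open>a\<close> is generalised in the induction because every
  derivative pulls out another factor \<open>e\<close>. With both factors equal to 1 or -1 this is
  the change from an atlas to its sign-modified charts.\<close>

lemma Ck_on_scale:
  assumes "Ck_on k S f" "open T" "\<And>y. y \<in> T \<Longrightarrow> e *\<^sub>R y \<in> S"
  shows "Ck_on k T (\<lambda>y. a *\<^sub>R f (e *\<^sub>R y))"
  using assms(1)
proof (induction k arbitrary: f a)
  case 0
  have "continuous_on T (\<lambda>y. f (e *\<^sub>R y))"
    using 0 assms(3) by (auto intro!: continuous_intros continuous_on_compose2[of S f "T" "\<lambda>y. e *\<^sub>R y"])
  then show ?case
    by (auto intro!: continuous_intros)
next
  case (Suc k)
  have d: "f differentiable (at (e *\<^sub>R y))" if "y \<in> T" for y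
    using Suc.prems assms(3)[OF that] by auto
  have "Ck_on k T (\<lambda>y. der (\<lambda>y. a *\<^sub>R f (e *\<^sub>R y)) y v)" for v
  proof (rule Ck_on_cong[OF assms(2)])
    show "Ck_on k T (\<lambda>y. (a * e) *\<^sub>R der f (e *\<^sub>R y) v)"
      using Suc.prems by (intro Suc.IH[of "\<lambda>y. der f y v" "a * e"]) simp
  qed (rule der_scale(2)[OF d, symmetric])
  moreover have "(\<lambda>y. a *\<^sub>R f (e *\<^sub>R y)) differentiable (at y)" if "y \<in> T" for y
    by (rule der_scale(1)[OF d[OF that]])
  ultimately show ?case by simp
qed

lemma der_inner:
  assumes "f differentiable (at x)"
  shows "(\<lambda>y. f y \<bullet> b) differentiable (at x)" and "der (\<lambda>y. f y \<bullet> b) x v = der f x v \<bullet> b"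
proof -
  have *: "((\<lambda>y. f y \<bullet> b) has_derivative (\<lambda>v. der f x v \<bullet> b)) (at x)"
    by (intro has_derivative_inner_left der_works assms)
  then show "(\<lambda>y. f y \<bullet> b) differentiable (at x)"
    unfolding differentiable_def by blast
  show "der (\<lambda>y. f y \<bullet> b) x v = der f x v \<bullet> b"
    by (simp add: der_eqI[OF *])
qed

lemma Ck_on_inner: "open S \<Longrightarrow> Ck_on k S f \<Longrightarrow> Ck_on k S (\<lambda>y. f y \<bullet> b)"
proof (induction k arbitrary: f)
  case 0
  then show ?case by (auto intro!: continuous_intros)
next
  case (Suc k)
  have "Ck_on k S (\<lambda>y. der (\<lambda>y. f y \<bullet> b) y v)" for v
  proof (rule Ck_on_cong[OF Suc.prems(1)])
    show "Ck_on k S (\<lambda>y. der f y v \<bullet> b)"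
      using Suc.prems by (intro Suc.IH[of "\<lambda>y. der f y v"]) simp_all
  qed (use Suc.prems in \<open>simp add: der_inner(2)\<close>)
  then show ?case using Suc.prems der_inner(1)[of f] by auto
qed

lemma Ck_on_const: "Ck_on k S (\<lambda>x. c)"
  by (induction k arbitrary: c) (auto simp: differentiable_const)

lemma smooth_on_const: "smooth_on S (\<lambda>x. c)"
  by (simp add: smooth_on_def Ck_on_const)

lemma smooth_on_differentiable: "smooth_on S f \<Longrightarrow> x \<in> S \<Longrightarrow> f differentiable (at x)"
  unfolding smooth_on_def by (metis Ck_on.simps(2))

lemma smooth_on_der: "smooth_on S f \<Longrightarrow> smooth_on S (\<lambda>x. der f x v)"
  unfolding smooth_on_def by (metis Ck_on.simps(2))

section \<open>Symmetry of second derivatives\<close>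

lemma mvt_line:
  fixes f :: "'a::euclidean_space \<Rightarrow> real"
  assumes "\<And>s. 0 \<le> s \<Longrightarrow> s \<le> h \<Longrightarrow> f differentiable (at (p + s *\<^sub>R u))" "0 < h"
  obtains s where "0 < s" "s < h" "f (p + h *\<^sub>R u) - f p = h * der f (p + s *\<^sub>R u) u"
proof -
  have D: "((\<lambda>s. f (p + s *\<^sub>R u)) has_derivative (\<lambda>r. der f (p + s *\<^sub>R u) (r *\<^sub>R u))) (at s)"
    if "0 \<le> s" "s \<le> h" for s
    by (rule has_derivative_compose[where g = f and g' = "der f (p + s *\<^sub>R u)"])
       (auto intro!: derivative_eq_intros der_works[OF assms(1)[OF that]])
  then have D': "((\<lambda>s. f (p + s *\<^sub>R u)) has_derivative (\<lambda>r. der f (p + s *\<^sub>R u) (r *\<^sub>R u))) (at s within {0..h})"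
    if "0 \<le> s" "s \<le> h" for s
    using that has_derivative_at_withinI by blast
  obtain s where s: "s \<in> {0<..<h}"
    and eq: "f (p + h *\<^sub>R u) - f (p + 0 *\<^sub>R u) = der f (p + s *\<^sub>R u) ((h - 0) *\<^sub>R u)"
    using mvt_simple[OF assms(2), of "\<lambda>s. f (p + s *\<^sub>R u)" "\<lambda>s r. der f (p + s *\<^sub>R u) (r *\<^sub>R u)"] D'
    by auto
  have "linear (der f (p + s *\<^sub>R u))" using s assms(1) by (intro linear_der) auto
  then show ?thesis using that[of s] s eq by (auto simp: linear_cmul)
qed

text \<open>The mean value theorem applied twice: along \<open>u\<close> to the increment of
  \<open>f\<close> by \<open>h *\<^sub>R v\<close>, then along \<open>v\<close> to the derivative in
  direction \<open>u\<close>.\<close>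

lemma second_difference:
  fixes f :: "'a::euclidean_space \<Rightarrow> real"
  assumes C: "Ck_on 2 S f" and h: "0 < h"
    and S: "\<And>s t. 0 \<le> s \<Longrightarrow> s \<le> h \<Longrightarrow> 0 \<le> t \<Longrightarrow> t \<le> h \<Longrightarrow> x + s *\<^sub>R u + t *\<^sub>R v \<in> S"
  obtains s t where "0 < s" "s < h" "0 < t" "t < h"
    "f (x + h *\<^sub>R u + h *\<^sub>R v) - f (x + h *\<^sub>R u) - f (x + h *\<^sub>R v) + f x =
       h\<^sup>2 * der (\<lambda>y. der f y u) (x + s *\<^sub>R u + t *\<^sub>R v) v"
proof -
  have df: "f differentiable (at y)" and ddf: "(\<lambda>y. der f y u) differentiable (at y)" if "y \<in> S" for y
    using C that by (auto simp: numeral_2_eq_2)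
  define F where "F = (\<lambda>y. f (y + h *\<^sub>R v) - f y)"
  have F: "(F has_derivative (\<lambda>w. der f (x + s *\<^sub>R u + h *\<^sub>R v) w - der f (x + s *\<^sub>R u) w)) (at (x + s *\<^sub>R u))"
    if "0 \<le> s" "s \<le> h" for s
  proof -
    have "x + s *\<^sub>R u \<in> S" "x + s *\<^sub>R u + h *\<^sub>R v \<in> S"
      using S[of s 0] S[of s h] that h by auto
    note S = this
    have "((\<lambda>y. f (y + h *\<^sub>R v)) has_derivative der f (x + s *\<^sub>R u + h *\<^sub>R v)) (at (x + s *\<^sub>R u))"
      by (rule has_derivative_compose[where g = f and g' = "der f (x + s *\<^sub>R u + h *\<^sub>R v)"
            and f' = "\<lambda>w. w"])
         (auto intro!: derivative_eq_intros der_works[OF df[OF S(2)]])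
    then show ?thesis unfolding F_def
      by (intro has_derivative_diff der_works df S)
  qed
  obtain s where s: "0 < s" "s < h" and e1: "F (x + h *\<^sub>R u) - F x = h * der F (x + s *\<^sub>R u) u"
    using mvt_line[of h F x u] F h unfolding differentiable_def by blast
  have e2: "der F (x + s *\<^sub>R u) u = der f (x + s *\<^sub>R u + h *\<^sub>R v) u - der f (x + s *\<^sub>R u) u"
    using der_eqI[OF F] s by simp
  obtain t where t: "0 < t" "t < h"
    and e3: "der f (x + s *\<^sub>R u + h *\<^sub>R v) u - der f (x + s *\<^sub>R u) u =
             h * der (\<lambda>y. der f y u) (x + s *\<^sub>R u + t *\<^sub>R v) v"
    using mvt_line[of h "\<lambda>y. der f y u" "x + s *\<^sub>R u" v] ddf S[of s] s h by auto
  have "f (x + h *\<^sub>R u + h *\<^sub>R v) - f (x + h *\<^sub>R u) - f (x + h *\<^sub>R v) + f x = F (x + h *\<^sub>R u) - F x"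
    by (simp add: F_def)
  then show ?thesis
    using that[OF s t] e1 e2 e3 by (simp add: power2_eq_square)
qed

lemma der_der_commute_real:
  fixes f :: "'a::euclidean_space \<Rightarrow> real"
  assumes C: "Ck_on 2 S f" and "open S" "x \<in> S"
  shows "der (\<lambda>y. der f y u) x v = der (\<lambda>y. der f y v) x u"
proof (rule ccontr)
  define P where "P = (\<lambda>y. der (\<lambda>y. der f y u) y v)"
  define Q where "Q = (\<lambda>y. der (\<lambda>y. der f y v) y u)"
  assume "der (\<lambda>y. der f y u) x v \<noteq> der (\<lambda>y. der f y v) x u"
  then have ne: "P x \<noteq> Q x" by (simp add: P_def Q_def)
  define e where "e = \<bar>P x - Q x\<bar> / 2"
  have e: "e > 0" using ne by (simp add: e_def)
  have "continuous_on S P" "continuous_on S Q"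
    using C by (auto simp: P_def Q_def numeral_2_eq_2)
  then have "isCont P x" "isCont Q x"
    using assms(2,3) continuous_on_eq_continuous_at by auto
  then obtain d1 d2 where d: "d1 > 0" "\<And>y. dist y x < d1 \<Longrightarrow> dist (P y) (P x) < e"
    "d2 > 0" "\<And>y. dist y x < d2 \<Longrightarrow> dist (Q y) (Q x) < e"
    unfolding continuous_at_eps_delta using e by (metis dist_commute)
  obtain r where r: "r > 0" "ball x r \<subseteq> S" using assms(2,3) open_contains_ball by blast
  define d0 where "d0 = min r (min d1 d2)"
  \<comment> \<open>Small enough that the whole parallelogram of side factor \<open>h\<close> stays
    within distance \<open>d0\<close> of \<open>x\<close>; the summand 1 keeps the denominator
    positive when \<open>u\<close> and \<open>v\<close> vanish.\<close>
  define h where "h = d0 / (2 * (norm u + norm v + 1))"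
  have nn: "norm u + norm v + 1 > 0" using norm_ge_zero[of u] norm_ge_zero[of v] by linarith
  have d0: "d0 > 0" using d r by (simp add: d0_def)
  have h: "h > 0" using d0 nn by (simp add: h_def)
  have near: "dist (x + s *\<^sub>R u + t *\<^sub>R v) x < d0" if "0 \<le> s" "s \<le> h" "0 \<le> t" "t \<le> h" for s t
  proof -
    have "dist (x + s *\<^sub>R u + t *\<^sub>R v) x = norm (s *\<^sub>R u + t *\<^sub>R v)" by (simp add: dist_norm)
    also have "\<dots> \<le> s * norm u + t * norm v"
      using norm_triangle_ineq[of "s *\<^sub>R u" "t *\<^sub>R v"] that by simp
    also have "\<dots> \<le> h * norm u + h * norm v"
      using that by (intro add_mono mult_right_mono) auto
    also have "\<dots> \<le> h * (norm u + norm v + 1)" using h by (simp add: algebra_simps)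
    also have "\<dots> = d0 / 2" using nn by (simp add: h_def field_simps)
    also have "\<dots> < d0" using d0 by simp
    finally show ?thesis .
  qed
  then have inS: "x + s *\<^sub>R u + t *\<^sub>R v \<in> S" if "0 \<le> s" "s \<le> h" "0 \<le> t" "t \<le> h" for s t
  proof -
    have "dist (x + s *\<^sub>R u + t *\<^sub>R v) x < r" using near[OF that] by (simp add: d0_def)
    then show ?thesis using r(2) by (auto simp: dist_commute)
  qed
  have inS': "x + s *\<^sub>R v + t *\<^sub>R u \<in> S" if "0 \<le> s" "s \<le> h" "0 \<le> t" "t \<le> h" for s t
    using inS[of t s] that by (simp add: add.commute add.left_commute)
  obtain s t where st: "0 < s" "s < h" "0 < t" "t < h" and
    E1: "f (x + h *\<^sub>R u + h *\<^sub>R v) - f (x + h *\<^sub>R u) - f (x + h *\<^sub>R v) + f x = h\<^sup>2 * P (x + s *\<^sub>R u + t *\<^sub>R v)"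
    unfolding P_def by (rule second_difference[OF C h, of x u v]) (use inS in blast)+
  obtain s' t' where st': "0 < s'" "s' < h" "0 < t'" "t' < h" and
    E2: "f (x + h *\<^sub>R v + h *\<^sub>R u) - f (x + h *\<^sub>R v) - f (x + h *\<^sub>R u) + f x = h\<^sup>2 * Q (x + s' *\<^sub>R v + t' *\<^sub>R u)"
    unfolding Q_def by (rule second_difference[OF C h, of x v u]) (use inS' in blast)+
  \<comment> \<open>The second difference is symmetric in \<open>u\<close> and \<open>v\<close>, so
    a value of \<open>P\<close> near \<open>x\<close> equals a value of \<open>Q\<close> near
    \<open>x\<close>. Each is within half of the supposed gap of its value at
    \<open>x\<close>.\<close>
  have "h\<^sup>2 * P (x + s *\<^sub>R u + t *\<^sub>R v) = h\<^sup>2 * Q (x + t' *\<^sub>R u + s' *\<^sub>R v)"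
    using E1 E2 by (simp add: algebra_simps)
  then have PQ: "P (x + s *\<^sub>R u + t *\<^sub>R v) = Q (x + t' *\<^sub>R u + s' *\<^sub>R v)" using h by simp
  have "dist (P (x + s *\<^sub>R u + t *\<^sub>R v)) (P x) < e"
    using near[of s t] st by (intro d(2)) (auto simp: d0_def)
  moreover have "dist (Q (x + t' *\<^sub>R u + s' *\<^sub>R v)) (Q x) < e"
    using near[of t' s'] st' by (intro d(4)) (auto simp: d0_def)
  ultimately show False using PQ unfolding e_def dist_real_def
    by (auto simp: abs_real_def split: if_splits)
qed

lemma der_der_commute:
  fixes f :: "'a::euclidean_space \<Rightarrow> 'b::euclidean_space"
  assumes "smooth_on S f" and "open S" "x \<in> S"
  shows "der (\<lambda>y. der f y u) x v = der (\<lambda>y. der f y v) x u"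
proof (rule euclidean_eqI)
  fix b :: 'b
  have d: "f differentiable (at y)" "(\<lambda>y. der f y w) differentiable (at y)" if "y \<in> S" for y w
    using smooth_on_differentiable smooth_on_der assms(1) that by blast+
  have "der (\<lambda>y. der f y u) x v \<bullet> b = der (\<lambda>y. der (\<lambda>y. f y \<bullet> b) y u) x v" for u v
  proof -
    have "der (\<lambda>y. der f y u) x v \<bullet> b = der (\<lambda>y. der f y u \<bullet> b) x v"
      using der_inner(2)[OF d(2)[OF assms(3)]] by simp
    also have "\<dots> = der (\<lambda>y. der (\<lambda>y. f y \<bullet> b) y u) x v"
      by (rule fun_cong[OF der_cong_open[OF assms(2,3)]]) (simp add: der_inner(2)[OF d(1)])
    finally show ?thesis .
  qed
  moreover have "Ck_on 2 S (\<lambda>y. f y \<bullet> b)"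
    using Ck_on_inner[OF assms(2)] assms(1) by (auto simp: smooth_on_def)
  ultimately show "der (\<lambda>y. der f y u) x v \<bullet> b = der (\<lambda>y. der f y v) x u \<bullet> b"
    using der_der_commute_real[OF _ assms(2,3)] by simp
qed

section \<open>Product rules for tensor-like families\<close>

text \<open>Only pointwise differentiability in each fixed argument is assumed; joint differentiability
  comes from linearity in finite dimension.\<close>

lemma has_derivative_linear_family:
  fixes A :: "'a::real_normed_vector \<Rightarrow> 'b::euclidean_space \<Rightarrow> 'c::real_normed_vector"
  assumes lin: "\<forall>\<^sub>F y in nhds x. linear (A y)"
    and A: "\<And>v. (\<lambda>y. A y v) differentiable (at x)" and W: "W differentiable (at x)"
  shows "((\<lambda>y. A y (W y)) has_derivative (\<lambda>h. der (\<lambda>y. A y (W x)) x h + A x (der W x h))) (at x)"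
proof -
  have linx: "linear (A x)" using lin eventually_nhds_x_imp_x by blast
  have expand: "A y v = (\<Sum>b\<in>Basis. (v \<bullet> b) *\<^sub>R A y b)" if "linear (A y)" for y v
    by (subst euclidean_representation[of v, symmetric], subst linear_sum[OF that])
       (simp add: linear_cmul[OF that])
  \<comment> \<open>In a basis the family is a finite sum of products of differentiable functions.
    This sum equals \<open>A y (V y)\<close> only where \<open>A y\<close> is linear, hence the
    passage to a neighbourhood in \<open>ev\<close>.\<close>
  have sum: "((\<lambda>y. \<Sum>b\<in>Basis. (V y \<bullet> b) *\<^sub>R A y b) has_derivative
      (\<lambda>h. \<Sum>b\<in>Basis. (V x \<bullet> b) *\<^sub>R der (\<lambda>y. A y b) x h + (der V x h \<bullet> b) *\<^sub>R A x b)) (at x)"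
    if "V differentiable (at x)" for V :: "'a \<Rightarrow> 'b"
    by (intro has_derivative_sum has_derivative_scaleR has_derivative_inner_left der_works that A)
  have ev: "((\<lambda>y. A y (V y)) has_derivative
      (\<lambda>h. \<Sum>b\<in>Basis. (V x \<bullet> b) *\<^sub>R der (\<lambda>y. A y b) x h + (der V x h \<bullet> b) *\<^sub>R A x b)) (at x)"
    if V: "V differentiable (at x)" for V :: "'a \<Rightarrow> 'b"
  proof -
    obtain U where U: "open U" "x \<in> U" "\<And>y. y \<in> U \<Longrightarrow> linear (A y)"
      using lin unfolding eventually_nhds by blast
    show ?thesis
      by (rule has_derivative_transform_within_open[OF sum[OF V] U(1,2)]) (simp add: expand U(3))
  qed
  have "der (\<lambda>y. A y (W x)) x = (\<lambda>h. \<Sum>b\<in>Basis. (W x \<bullet> b) *\<^sub>R der (\<lambda>y. A y b) x h)"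
    using der_eqI[OF ev[of "\<lambda>y. W x"]] by simp
  moreover have "A x (der W x h) = (\<Sum>b\<in>Basis. (der W x h \<bullet> b) *\<^sub>R A x b)" for h
    by (rule expand[OF linx])
  ultimately show ?thesis using ev[OF W] by (simp add: sum.distrib)
qed

lemma eventually_in_open_nhds:
  assumes "f differentiable (at x)" "open S" "f x \<in> S"
  shows "\<forall>\<^sub>F y in nhds x. f y \<in> S"
proof -
  have "(f \<longlongrightarrow> f x) (at x)"
    using differentiable_imp_continuous_within[OF assms(1)] by (simp add: continuous_at)
  then have "(f \<longlongrightarrow> f x) (nhds x)" by (simp add: tendsto_at_iff_tendsto_nhds)
  then show ?thesis using assms(2,3) by (rule topological_tendstoD)
qed

lemma has_derivative_linear_family_along:
  fixes A :: "'a::real_normed_vector \<Rightarrow> 'b::euclidean_space \<Rightarrow> 'c::real_normed_vector"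
    and f :: "'d::real_normed_vector \<Rightarrow> 'a"
  assumes S: "open S" "f x \<in> S" and lin: "\<And>y. y \<in> S \<Longrightarrow> linear (A y)"
    and A: "\<And>v. (\<lambda>y. A y v) differentiable (at (f x))"
    and f: "f differentiable (at x)" and W: "W differentiable (at x)"
  shows "((\<lambda>y. A (f y) (W y)) has_derivative
    (\<lambda>h. der (\<lambda>y. A y (W x)) (f x) (der f x h) + A (f x) (der W x h))) (at x)"
proof -
  have c: "((\<lambda>y. A (f y) v) has_derivative (\<lambda>h. der (\<lambda>y. A y v) (f x) (der f x h))) (at x)" for v
    using has_derivative_compose[OF der_works[OF f] der_works[OF A[of v]]] by simp
  have "\<forall>\<^sub>F y in nhds x. f y \<in> S"
    by (rule eventually_in_open_nhds[OF f S])
  then have "\<forall>\<^sub>F y in nhds x. linear (A (f y))" by (rule eventually_mono) (rule lin)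
  then have "((\<lambda>y. A (f y) (W y)) has_derivative
    (\<lambda>h. der (\<lambda>y. A (f y) (W x)) x h + A (f x) (der W x h))) (at x)"
    by (rule has_derivative_linear_family) (use c W differentiable_def in blast)+
  then show ?thesis using der_eqI[OF c] by simp
qed

text \<open>The linear rule twice: first in \<open>V\<close> with the last argument frozen, then in
  \<open>W\<close>.\<close>

lemma has_derivative_bilinear_family_along:
  fixes A :: "'a::real_normed_vector \<Rightarrow> 'b::euclidean_space \<Rightarrow> 'b \<Rightarrow> 'c::real_normed_vector"
    and f :: "'d::real_normed_vector \<Rightarrow> 'a"
  assumes S: "open S" "f x \<in> S" and lin: "\<And>y. y \<in> S \<Longrightarrow> bilinear (A y)"
    and A: "\<And>v w. (\<lambda>y. A y v w) differentiable (at (f x))"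
    and f: "f differentiable (at x)" and V: "V differentiable (at x)" and W: "W differentiable (at x)"
  shows "((\<lambda>y. A (f y) (V y) (W y)) has_derivative
    (\<lambda>h. der (\<lambda>y. A y (V x) (W x)) (f x) (der f x h) + A (f x) (der V x h) (W x)
       + A (f x) (V x) (der W x h))) (at x)"
proof -
  have c: "((\<lambda>y. A (f y) (V y) w) has_derivative
      (\<lambda>h. der (\<lambda>y. A y (V x) w) (f x) (der f x h) + A (f x) (der V x h) w)) (at x)" for w
    using lin A by (intro has_derivative_linear_family_along[of S f x "\<lambda>y v. A y v w"] S f V)
      (auto simp: bilinear_def)
  have "\<forall>\<^sub>F y in nhds x. f y \<in> S"
    by (rule eventually_in_open_nhds[OF f S])
  then have "\<forall>\<^sub>F y in nhds x. linear (A (f y) (V y))"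
    by (rule eventually_mono) (use lin bilinear_def in blast)
  then have "((\<lambda>y. A (f y) (V y) (W y)) has_derivative
    (\<lambda>h. der (\<lambda>y. A (f y) (V y) (W x)) x h + A (f x) (V x) (der W x h))) (at x)"
    by (rule has_derivative_linear_family) (use c W differentiable_def in blast)+
  then show ?thesis using der_eqI[OF c] by simp
qed

section \<open>Nearly Kaehler tensors at a point\<close>

locale inner_form =
  fixes G :: "'a::euclidean_space \<Rightarrow> 'a \<Rightarrow> real"
  assumes G_bilinear: "bilinear G" and G_sym: "G v w = G w v" and G_pos: "v \<noteq> 0 \<Longrightarrow> G v v > 0"
begin

lemma G_linear: "linear (G v)" "linear (\<lambda>v. G v w)"
  using G_bilinear by (auto simp: bilinear_def)

lemma G_simps [simp]:
  "G (v + v') w = G v w + G v' w" "G v (w + w') = G v w + G v w'"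
  "G (v - v') w = G v w - G v' w" "G v (w - w') = G v w - G v w'"
  "G (- v) w = - G v w" "G v (- w) = - G v w"
  "G (r *\<^sub>R v) w = r * G v w" "G v (r *\<^sub>R w) = r * G v w"
  "G 0 w = 0" "G v 0 = 0"
  using G_bilinear
  by (simp_all add: bilinear_ladd bilinear_radd bilinear_lsub bilinear_rsub bilinear_lneg bilinear_rneg
      bilinear_lmul bilinear_rmul bilinear_lzero bilinear_rzero)

lemma G_sum: "G (sum f S) w = (\<Sum>i\<in>S. G (f i) w)" "G w (sum f S) = (\<Sum>i\<in>S. G w (f i))"
  using linear_sum[OF G_linear(1)] linear_sum[OF G_linear(2)] by auto

text \<open>Pairing with an element of \<open>X\<close> reads off its coefficient, so
  \<open>X\<close> is independent; having as many elements as the dimension, it spans.\<close>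

lemma orthonormal_expansion:
  assumes X: "finite X" "card X = DIM('a)" and on: "\<And>x y. x \<in> X \<Longrightarrow> y \<in> X \<Longrightarrow> G x y = (if x = y then 1 else 0)"
  shows "v = (\<Sum>x\<in>X. G v x *\<^sub>R x)"
proof -
  have coord: "G (\<Sum>x\<in>X. c x *\<^sub>R x) y = c y" if "y \<in> X" for c y
  proof -
    have "G (\<Sum>x\<in>X. c x *\<^sub>R x) y = (\<Sum>x\<in>X. if x = y then c x else 0)"
      unfolding G_sum by (rule sum.cong) (use on that in auto)
    then show ?thesis using X(1) that by simp
  qed
  have "independent X"
  proof (rule independent_if_scalars_zero[OF X(1)])
    fix c x assume "(\<Sum>x\<in>X. c x *\<^sub>R x) = 0" "x \<in> X"
    then show "c x = 0" using coord[of x c] by simp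
  qed
  then have "v \<in> span X"
    using card_ge_dim_independent[of X UNIV] X by (auto simp: dim_UNIV)
  then obtain c where c: "v = (\<Sum>x\<in>X. c x *\<^sub>R x)"
    using span_finite[OF X(1)] by auto
  then have "G v x = c x" if "x \<in> X" for x using coord[OF that] by simp
  then have "(\<Sum>x\<in>X. G v x *\<^sub>R x) = (\<Sum>x\<in>X. c x *\<^sub>R x)" by simp
  then show ?thesis using c by simp
qed

lemma normalize:
  assumes "v \<noteq> 0"
  shows "G ((1 / sqrt (G v v)) *\<^sub>R v) ((1 / sqrt (G v v)) *\<^sub>R v) = 1"
  using G_pos[OF assms] by simp

lemma orthonormal_triple_exists:
  assumes "DIM('a) \<ge> 3"
  obtains w1 w2 w3 where "G w1 w1 = 1" "G w2 w2 = 1" "G w3 w3 = 1"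
    "G w1 w2 = 0" "G w1 w3 = 0" "G w2 w3 = 0"
proof -
  \<comment> \<open>One Gram-Schmidt step: fewer than three vectors cannot span, so some
    \<open>u\<close> lies outside, and its component orthogonal to \<open>X\<close> is
    nonzero.\<close>
  have new: "\<exists>w. G w w = 1 \<and> (\<forall>x\<in>X. G x w = 0)"
    if X: "finite X" "card X < 3" "\<And>x y. x \<in> X \<Longrightarrow> y \<in> X \<Longrightarrow> G x y = (if x = y then 1 else 0)" for X
  proof -
    have "dim (span X) < DIM('a)"
      using dim_le_card[OF _ X(1), of "span X"] X assms by simp
    then have "span X \<noteq> UNIV" by (metis dim_UNIV nat_less_le)
    then obtain u where u: "u \<notin> span X" by auto
    define w where "w = u - (\<Sum>x\<in>X. G u x *\<^sub>R x)"
    have "(\<Sum>x\<in>X. G u x *\<^sub>R x) \<in> span X" by (intro span_sum span_scale span_base)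
    then have "w \<noteq> 0" using u by (auto simp: w_def)
    have "G w y = 0" if "y \<in> X" for y
    proof -
      have "G (\<Sum>x\<in>X. G u x *\<^sub>R x) y = (\<Sum>x\<in>X. if x = y then G u x else 0)"
        unfolding G_sum by (rule sum.cong) (use X that in auto)
      then show ?thesis using X(1) that by (simp add: w_def)
    qed
    then show ?thesis using normalize[OF \<open>w \<noteq> 0\<close>] G_sym
      by (intro exI[of _ "(1 / sqrt (G w w)) *\<^sub>R w"]) auto
  qed
  obtain w1 where w1: "G w1 w1 = 1" using new[of "{}"] by auto
  obtain w2 where w2: "G w2 w2 = 1" "G w1 w2 = 0" using new[of "{w1}"] w1 by auto
  have "w1 \<noteq> w2" using w1 w2 by auto
  then obtain w3 where "G w3 w3 = 1" "G w1 w3 = 0" "G w2 w3 = 0"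
    using new[of "{w1,w2}"] w1 w2 G_sym[of w2 w1] by force
  then show ?thesis using that w1 w2 by blast
qed

end

section \<open>Hermitian forms and Lagrangian frames\<close>

locale hermitian_form = inner_form G for G :: "'a::euclidean_space \<Rightarrow> 'a \<Rightarrow> real" +
  fixes J :: "'a \<Rightarrow> 'a"
  assumes J_linear: "linear J" and J_J [simp]: "J (J v) = - v" and G_J_J [simp]: "G (J v) (J w) = G v w"
begin

lemma J_simps [simp]: "J (v + w) = J v + J w" "J (v - w) = J v - J w" "J (- v) = - J v"
  "J (r *\<^sub>R v) = r *\<^sub>R J v" "J 0 = 0"
  using J_linear by (simp_all add: linear_add linear_diff linear_neg linear_cmul linear_0)

lemma G_J_left: "G (J v) w = - G v (J w)"
  using G_J_J[of v "J w"] by simp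

lemma G_J_self [simp]: "G (J v) v = 0" "G v (J v) = 0"
  using G_J_left[of v v] G_sym[of v "J v"] by auto

text \<open>In real dimension six this is a unitary basis: the frame together with its image under
  \<open>J\<close> is an orthonormal basis.\<close>

definition lagrangian_frame :: "'a \<Rightarrow> 'a \<Rightarrow> 'a \<Rightarrow> bool" where
  "lagrangian_frame e1 e2 e3 \<longleftrightarrow>
     G e1 e1 = 1 \<and> G e2 e2 = 1 \<and> G e3 e3 = 1 \<and> G e1 e2 = 0 \<and> G e1 e3 = 0 \<and> G e2 e3 = 0 \<and>
     G (J e1) e2 = 0 \<and> G (J e1) e3 = 0 \<and> G (J e2) e3 = 0"

lemma lagrangian_frame_simps:
  assumes "lagrangian_frame e1 e2 e3"
  shows "G e1 e1 = 1" "G e2 e2 = 1" "G e3 e3 = 1" "G e1 e2 = 0" "G e1 e3 = 0" "G e2 e3 = 0"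
    "G e2 e1 = 0" "G e3 e1 = 0" "G e3 e2 = 0"
    "G (J e1) e2 = 0" "G (J e1) e3 = 0" "G (J e2) e3 = 0" "G (J e2) e1 = 0" "G (J e3) e1 = 0" "G (J e3) e2 = 0"
    "G e1 (J e2) = 0" "G e1 (J e3) = 0" "G e2 (J e3) = 0" "G e2 (J e1) = 0" "G e3 (J e1) = 0" "G e3 (J e2) = 0"
  using assms unfolding lagrangian_frame_def using G_sym G_J_left
  by (metis neg_equal_0_iff_equal)+

lemma frame_expansion:
  assumes fr: "lagrangian_frame e1 e2 e3" and dim: "DIM('a) = 6"
  shows "v = G v e1 *\<^sub>R e1 + G v e2 *\<^sub>R e2 + G v e3 *\<^sub>R e3
    + G v (J e1) *\<^sub>R J e1 + G v (J e2) *\<^sub>R J e2 + G v (J e3) *\<^sub>R J e3"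
proof -
  note s = lagrangian_frame_simps[OF fr]
  have ne: "G x y = 0 \<Longrightarrow> G x x = 1 \<Longrightarrow> x \<noteq> y" for x y by auto
  have d: "distinct [e1, e2, e3, J e1, J e2, J e3]"
    using s ne[of e1 "J e1"] ne[of e2 "J e2"] ne[of e3 "J e3"] ne[of "J e1" "J e2"]
      ne[of "J e1" "J e3"] ne[of "J e2" "J e3"] by (auto dest: ne)
  let ?X = "{e1, e2, e3, J e1, J e2, J e3}"
  have "card ?X = 6" using distinct_card[OF d] by simp
  then have "v = (\<Sum>x\<in>?X. G v x *\<^sub>R x)"
    using dim d by (intro orthonormal_expansion) (auto simp: s)
  then show ?thesis using d by (simp add: add.assoc)
qed

lemma frame_inner:
  assumes fr: "lagrangian_frame e1 e2 e3" and dim: "DIM('a) = 6"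
  shows "G v w = G v e1 * G w e1 + G v e2 * G w e2 + G v e3 * G w e3
    + G v (J e1) * G w (J e1) + G v (J e2) * G w (J e2) + G v (J e3) * G w (J e3)"
  by (subst frame_expansion[OF fr dim, of v]) (simp add: G_sym[of w])

lemma frame_eq_0:
  assumes "lagrangian_frame e1 e2 e3" "DIM('a) = 6"
    "G v e1 = 0" "G v e2 = 0" "G v e3 = 0" "G v (J e1) = 0" "G v (J e2) = 0" "G v (J e3) = 0"
  shows "v = 0"
  by (subst frame_expansion[OF assms(1,2), of v]) (simp add: assms)

end

text \<open>The tensors at one point: \<open>N v w = (\<nabla>\<^sub>v J) w\<close>, \<open>B a v w = (\<nabla>\<^sup>2\<^bsub>a,v\<^esub> J) w\<close> and the
  curvature \<open>R\<close>.\<close>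

locale nk_tensors = hermitian_form G J for G :: "'a::euclidean_space \<Rightarrow> 'a \<Rightarrow> real" and J +
  fixes N :: "'a \<Rightarrow> 'a \<Rightarrow> 'a"
  assumes N_bilinear: "bilinear N" and N_self [simp]: "N v v = 0"
    and N_J [simp]: "N v (J w) = - J (N v w)"
    and N_G: "G (N u v) w = - G v (N u w)"
begin

lemma N_simps [simp]:
  "N (v + v') w = N v w + N v' w" "N v (w + w') = N v w + N v w'"
  "N (- v) w = - N v w" "N v (- w) = - N v w"
  "N (r *\<^sub>R v) w = r *\<^sub>R N v w" "N v (r *\<^sub>R w) = r *\<^sub>R N v w"
  "N 0 w = 0" "N v 0 = 0"
  using N_bilinear
  by (simp_all add: bilinear_ladd bilinear_radd bilinear_lneg bilinear_rneg
      bilinear_lmul bilinear_rmul bilinear_lzero bilinear_rzero)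

lemma N_skew: "N v w = - N w v"
proof -
  have "N (v + w) (v + w) = 0" by (rule N_self)
  then have "N v w + N w v = 0" unfolding N_simps(1,2) by (simp add: add.commute)
  then show ?thesis by (simp only: eq_neg_iff_add_eq_0)
qed

lemma J_N [simp]: "N (J v) w = - J (N v w)"
  by (subst (1 2) N_skew) simp

definition T :: "'a \<Rightarrow> 'a \<Rightarrow> 'a \<Rightarrow> real" where
  "T u v w = G (N u v) w"

lemma T_simps [simp]:
  "T (v + v') w z = T v w z + T v' w z" "T v (w + w') z = T v w z + T v w' z" "T v w (z + z') = T v w z + T v w z'"
  "T (- v) w z = - T v w z" "T v (- w) z = - T v w z" "T v w (- z) = - T v w z"
  "T (r *\<^sub>R v) w z = r * T v w z" "T v (r *\<^sub>R w) z = r * T v w z" "T v w (r *\<^sub>R z) = r * T v w z"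
  "T v v w = 0"
  by (simp_all add: T_def)

lemma T_skew: "T u v w = - T v u w" "T u v w = - T u w v"
   apply (metis N_skew T_def T_simps(4) G_simps(5))
  by (metis G_sym N_G T_def)

lemma T_self [simp]: "T u v v = 0" "T u v u = 0"
  using T_skew(2)[of u v v] T_skew(2)[of u v u] by auto

text \<open>The type condition (3,0) + (0,3): \<open>J\<close> may be moved freely among the three
  arguments.\<close>

lemma T_J: "T (J u) v w = T u v (J w)" "T u (J v) w = T u v (J w)"
  by (simp_all add: T_def G_J_left)

lemma T_J_self [simp]: "T u v (J v) = 0" "T u v (J u) = 0"
  using T_J[of u v u] T_J[of u v v] T_skew(1)[of u "J v" v] T_skew(2)[of u "J v" v] by simp_all

text \<open>\<open>N e1 e2\<close> can only have components along \<open>e3\<close> and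
  \<open>J e3\<close>, and \<open>N e1 e3\<close> only along \<open>e2\<close> and
  \<open>J e2\<close>. All of these are, up to sign, the two numbers \<open>T e1 e2 e3\<close> and
  \<open>T e1 e2 (J e3)\<close>. If both vanish then so does \<open>N e1\<close>, as
  \<open>N e1\<close> anticommutes with \<open>J\<close>.\<close>

lemma T_frame_nonzero:
  assumes fr: "lagrangian_frame e1 e2 e3" and dim: "DIM('a) = 6"
    and T0: "T e1 e2 e3 = 0" and strict: "N e1 w \<noteq> 0"
  shows "T e1 e2 (J e3) \<noteq> 0"
proof
  assume T1: "T e1 e2 (J e3) = 0"
  have T2: "T e1 e3 (J e2) = 0"
    using T_skew(2)[of e1 e3 "J e2"] T_J(2)[of e1 e2 e3] T1 by simp
  have "N e1 e2 = 0"
    using T0 T1 by (intro frame_eq_0[OF fr dim]) (simp_all flip: T_def)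
  moreover have "N e1 e3 = 0"
    using T0 T2 T_skew(2)[of e1 e3 e2] by (intro frame_eq_0[OF fr dim]) (simp_all flip: T_def)
  ultimately have "N e1 w = 0"
    by (subst frame_expansion[OF fr dim, of w]) simp
  then show False using strict by simp
qed

end

text \<open>\<open>B_skew\<close>, \<open>B_G\<close> and \<open>B_J\<close> are the covariant
  derivatives of the identities \<open>N_skew\<close>, \<open>N_G\<close> and \<open>N_J\<close>;
  the terms quadratic in \<open>N\<close> come from the derivative of \<open>J\<close> itself. The
  assumptions on \<open>R\<close> are those of a Levi-Civita curvature, and
  \<open>Ricci_identity\<close> is the commutator of second covariant derivatives applied to
  \<open>J\<close>.\<close>

locale nk_curvature_tensors = nk_tensors G J N for G :: "'a::euclidean_space \<Rightarrow> 'a \<Rightarrow> real" and J N +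
  fixes B R :: "'a \<Rightarrow> 'a \<Rightarrow> 'a \<Rightarrow> 'a"
  assumes B_skew: "B a u v = - B a v u"
    and B_G: "G (B a u v) w = - G v (B a u w)"
    and B_J: "B a u (J v) = - J (B a u v) - N u (N a v) - N a (N u v)"
    and R_skew: "R a b v = - R b a v"
    and R_Bianchi: "R a b c + R b c a + R c a b = 0"
    and R_G: "G (R a b v) w = - G v (R a b w)"
    and Ricci_identity: "R a b (J v) - J (R a b v) = B a b v - B b a v"
begin

definition nabla_T :: "'a \<Rightarrow> 'a \<Rightarrow> 'a \<Rightarrow> 'a \<Rightarrow> real" where
  "nabla_T a u v w = G (B a u v) w"

definition Rm :: "'a \<Rightarrow> 'a \<Rightarrow> 'a \<Rightarrow> 'a \<Rightarrow> real" where
  "Rm a b u v = G (R a b u) v"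

lemma nabla_T_skew: "nabla_T a u v w = - nabla_T a v u w" "nabla_T a u v w = - nabla_T a u w v"
   apply (metis B_skew nabla_T_def G_simps(5))
  by (metis B_G G_sym nabla_T_def)

lemma nabla_T_self [simp]: "nabla_T a u u w = 0" "nabla_T a u v v = 0"
  using nabla_T_skew(1)[of a u u w] nabla_T_skew(2)[of a u v v] by auto

lemma nabla_T_neg [simp]: "nabla_T a u v (- w) = - nabla_T a u v w"
  by (simp add: nabla_T_def)

text \<open>Measures how far \<open>nabla_T a\<close> is from satisfying \<open>T_J\<close>: the
  defect is quadratic in \<open>N\<close>.\<close>

lemma nabla_T_J: "nabla_T a u (J v) w = nabla_T a u v (J w) + G (N u v) (N a w) + G (N a v) (N u w)"
  by (simp add: nabla_T_def B_J G_J_left N_G)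

lemma Rm_neg [simp]: "Rm a b u (- v) = - Rm a b u v"
  by (simp add: Rm_def)

lemma Rm_skew: "Rm a b u v = - Rm b a u v" "Rm a b u v = - Rm a b v u"
   apply (metis R_skew Rm_def G_simps(5))
  by (metis R_G G_sym Rm_def)

lemma Rm_Bianchi: "Rm a b c d + Rm b c a d + Rm c a b d = 0"
  unfolding Rm_def G_simps(1)[symmetric] R_Bianchi by simp

text \<open>The classical octahedron argument: the four Bianchi identities on \<open>a\<close>,
  \<open>b\<close>, \<open>c\<close>, \<open>d\<close>, combined linearly with the two skew
  symmetries.\<close>

lemma Rm_pair: "Rm a b c d = Rm c d a b"
  using Rm_Bianchi[of a b c d] Rm_Bianchi[of b c d a] Rm_Bianchi[of c d a b] Rm_Bianchi[of d a b c]
    Rm_skew(2)[of a b c d] Rm_skew(1)[of b c a d] Rm_skew(2)[of b c a d] Rm_skew[of c a b d]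
    Rm_skew[of a b d c] Rm_skew[of b d a c] Rm_skew[of d a b c] Rm_skew[of d a c b] Rm_skew[of c d a b]
    Rm_skew[of d b c a] Rm_skew[of d b a c] Rm_skew[of c a d b] Rm_skew[of a c d b] Rm_skew[of a c b d]
    Rm_skew[of b d c a] Rm_skew[of c d b a] Rm_skew[of b c d a] Rm_skew[of a d b c] Rm_skew[of a d c b]
  by linarith

lemma Ricci: "Rm a b (J u) v + Rm a b u (J v) = nabla_T a b u v - nabla_T b a u v"
proof -
  have "G (R a b (J u) - J (R a b u)) v = G (B a b u - B b a u) v"
    by (simp only: Ricci_identity)
  then show ?thesis by (simp add: Rm_def nabla_T_def G_J_left)
qed

text \<open>This is \<open>dd\<omega> = 0\<close>, since \<open>d\<omega> = 3 \<nabla>\<omega>\<close>.\<close>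

lemma nabla_T_alternation: "nabla_T a b c d - nabla_T b a c d + nabla_T c a b d - nabla_T d a b c = 0"
proof -
  have J: "Rm x y (J u) v = - Rm x y v (J u)" for x y u v by (rule Rm_skew)
  have dT3: "nabla_T x u w v = - nabla_T x u v w" "nabla_T x w u v = nabla_T x u v w" "nabla_T x v u w = - nabla_T x u v w" "nabla_T x v w u = nabla_T x u v w" for x u v w
    using nabla_T_skew(2)[of x u w v] nabla_T_skew(1)[of x w u v] nabla_T_skew(1)[of x v u w] nabla_T_skew(1)[of x v w u]
      nabla_T_skew(2)[of x w v u] nabla_T_skew(2)[of x u v w] by simp_all
  \<comment> \<open>The right-hand side has one bracket for each of the six pairs among the four
    vectors, so every term on the left arises three times. After \<open>Ricci\<close>, the curvature
    terms are grouped by the vector that carries \<open>J\<close>; each of the four groups is a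
    Bianchi sum.\<close>
  have "3 * (nabla_T a b c d - nabla_T b a c d + nabla_T c a b d - nabla_T d a b c) =
      (nabla_T a b c d - nabla_T b a c d) + (nabla_T c d a b - nabla_T d c a b) - (nabla_T a c b d - nabla_T c a b d)
    - (nabla_T b d a c - nabla_T d b a c) + (nabla_T a d b c - nabla_T d a b c) + (nabla_T b c a d - nabla_T c b a d)"
    using dT3[of a b c d] dT3[of b a c d] dT3[of c a b d] dT3[of d a b c] by simp
  also have "\<dots> = 0"
    unfolding Ricci[symmetric] J
    using Rm_Bianchi[of a b c "J d"] Rm_Bianchi[of a b d "J c"] Rm_Bianchi[of a c d "J b"] Rm_Bianchi[of b c d "J a"]
      Rm_skew(1)[of c a b "J d"] Rm_skew(1)[of d a b "J c"] Rm_skew(1)[of d a c "J b"] Rm_skew(1)[of d b c "J a"]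
    by simp
  finally show ?thesis by simp
qed

text \<open>In the complexified picture \<open>nabla_T a\<close> is of type \<open>(3,0) + (0,3)\<close> up to terms quadratic in \<open>N\<close>,
  which vanish on the index pattern \<open>1,1,2,3\<close>. What is left is killed by the pair symmetry of the
  curvature tensor.\<close>

lemma nabla_T_frame:
  assumes fr: "lagrangian_frame e1 e2 e3" and dim: "DIM('a) = 6"
  shows "nabla_T e1 e1 e2 e3 = 0"
proof -
  have T: "T e1 e3 e2 = - T e1 e2 e3" "T e1 e3 (J e2) = - T e1 e2 (J e3)"
    using T_skew(2)[of e1 e3 e2] T_skew(2)[of e1 e3 "J e2"] T_J(2)[of e1 e2 e3] by simp_all
  \<comment> \<open>The two vectors live in complementary planes, spanned by \<open>e3\<close>,
    \<open>J e3\<close> and by \<open>e2\<close>, \<open>J e2\<close>. Hence all quadratic defects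
    in \<open>nabla_T_J\<close> below drop out.\<close>
  have q: "G (N e1 e2) (N e1 e3) = 0" "G (N e1 e2) (J (N e1 e3)) = 0"
    by (subst frame_inner[OF fr dim]; simp add: G_J_left flip: T_def)+
  have N: "N e2 e1 = - N e1 e2" "N e3 e1 = - N e1 e3" by (rule N_skew)+
  \<comment> \<open>In \<open>a\<close> and \<open>c\<close>, moving \<open>J\<close> off
    \<open>J e1\<close> leaves \<open>e1\<close> in two skew slots. In \<open>b\<close> and
    \<open>d\<close> the two occurrences of \<open>J\<close> combine to -1 and a permutation
    restores the pattern \<open>e1\<close>, \<open>e2\<close>, \<open>e3\<close>.\<close>
  have a: "nabla_T e3 (J e1) e1 (J e2) = 0"
    using nabla_T_J[of e3 e1 e1 "J e2"] nabla_T_skew(1)[of e3 "J e1" e1] q by (simp add: N G_J_left G_sym[of "N e1 e3"])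
  have b: "nabla_T e1 (J e3) e1 (J e2) = - nabla_T e1 e1 e2 e3"
    using nabla_T_J[of e1 e1 e3 "J e2"] nabla_T_skew(1)[of e1 "J e3" e1] nabla_T_skew(2)[of e1 e1 e3 e2] q
    by (simp add: G_J_left G_sym[of "N e1 e3"] )
  have c: "nabla_T (J e2) (J e1) e1 e3 = 0"
    using nabla_T_J[of "J e2" e1 e1 e3] nabla_T_skew(1)[of "J e2" "J e1" e1] q by (simp add: N G_J_left)
  have d: "nabla_T e1 (J e1) e3 (J e2) = nabla_T e1 e1 e2 e3"
    using nabla_T_J[of e1 e3 e2 "J e1"] nabla_T_skew(1)[of e1 "J e1" e3] nabla_T_skew(2)[of e1 e3 "J e1" "J e2"]
      nabla_T_skew(2)[of e1 e3 e2 e1] nabla_T_skew(1)[of e1 e3 e1 e2] nabla_T_skew(2)[of e1 e1 e3 e2] q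
    by (simp add: N G_J_left)
  have x: "nabla_T (J e1) (J e2) e1 e3 = - nabla_T (J e1) e1 (J e2) e3" "nabla_T (J e1) e3 e1 (J e2) = nabla_T (J e1) e1 (J e2) e3"
      "nabla_T (J e1) e3 e1 (J e2) = - nabla_T (J e1) e1 e3 (J e2)"
    using nabla_T_skew(1)[of "J e1" "J e2" e1] nabla_T_skew(1)[of "J e1" e3 e1] nabla_T_skew(2)[of "J e1" e1 e3 "J e2"] by simp_all
  \<comment> \<open>The alternation identity converts a derivative in direction \<open>J e1\<close>
    into one in direction \<open>e1\<close>; its other two terms vanish by \<open>a\<close> and
    \<open>c\<close>.\<close>
  have alt: "nabla_T (J e1) e1 e3 (J e2) = nabla_T e1 e1 e2 e3"
    using nabla_T_alternation[of e1 "J e1" e3 "J e2"] a c d nabla_T_skew(1)[of e3 e1 "J e1"]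
      nabla_T_skew(1)[of "J e2" e1 "J e1"] by simp
  \<comment> \<open>Let X be the claimed quantity. The right-hand sides of the four Ricci identities
    are -X, X, -X, -X. By \<open>Rm_pair\<close>, the second minus the first has the same curvature
    terms as the sum of the last two, so 2X = -2X.\<close>
  show ?thesis
    using Ricci[of e1 e2 e1 e3] Ricci[of "J e1" "J e2" e1 e3]
      Ricci[of "J e1" e3 e1 "J e2"] Ricci[of e1 "J e3" e1 "J e2"] a b c x alt
      Rm_pair[of e1 e2 "J e1" e3] Rm_pair[of e1 e2 e1 "J e3"] Rm_pair[of "J e1" "J e2" "J e1" e3]
      Rm_pair[of "J e1" "J e2" e1 "J e3"] nabla_T_skew(1)[of e1 e2 e1 e3]
    by simp
qed

end

section \<open>Covariant derivatives in a chart\<close>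

lemma linear_der_family:
  fixes A :: "'a::real_normed_vector \<Rightarrow> 'b::real_vector \<Rightarrow> 'c::real_normed_vector"
  assumes S: "open S" "x \<in> S" and lin: "\<And>y. y \<in> S \<Longrightarrow> linear (A y)"
    and A: "\<And>v. (\<lambda>y. A y v) differentiable (at x)"
  shows "linear (\<lambda>v. der (\<lambda>y. A y v) x h)"
proof (rule linearI)
  fix v w r
  have "((\<lambda>y. A y v + A y w) has_derivative (\<lambda>h. der (\<lambda>y. A y v) x h + der (\<lambda>y. A y w) x h)) (at x)"
    by (intro has_derivative_add der_works A)
  moreover have "der (\<lambda>y. A y (v + w)) x = der (\<lambda>y. A y v + A y w) x"
    by (rule der_cong_open[OF S]) (simp add: linear_add[OF lin])
  ultimately show "der (\<lambda>y. A y (v + w)) x h = der (\<lambda>y. A y v) x h + der (\<lambda>y. A y w) x h"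
    by (simp add: der_eqI)
  have "((\<lambda>y. r *\<^sub>R A y v) has_derivative (\<lambda>h. r *\<^sub>R der (\<lambda>y. A y v) x h)) (at x)"
    by (intro has_derivative_scaleR_right der_works A)
  moreover have "der (\<lambda>y. A y (r *\<^sub>R v)) x = der (\<lambda>y. r *\<^sub>R A y v) x"
    by (rule der_cong_open[OF S]) (simp add: linear_cmul[OF lin])
  ultimately show "der (\<lambda>y. A y (r *\<^sub>R v)) x h = r *\<^sub>R der (\<lambda>y. A y v) x h"
    by (simp add: der_eqI)
qed

lemma der_minus: "f differentiable (at x) \<Longrightarrow> der (\<lambda>y. - f y) x h = - der f x h"
  using der_eqI[OF has_derivative_minus[OF der_works]] by metis

lemma der_add:
  "f differentiable (at x) \<Longrightarrow> f' differentiable (at x) \<Longrightarrow> der (\<lambda>y. f y + f' y) x h = der f x h + der f' x h"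
  using der_eqI[OF has_derivative_add[OF der_works der_works]] by metis

text \<open>The structure in one chart. Symmetry of \<open>\<Gamma>\<close>, metricity and the
  nearly Kaehler condition are recorded on fields with constant components only; the general product
  rules are recovered from these by linearity.\<close>

locale nk_chart =
  fixes S :: "(real ^ 'n::finite) set" and g :: "real ^ 'n \<Rightarrow> real ^ 'n \<Rightarrow> real ^ 'n \<Rightarrow> real"
    and J :: "real ^ 'n \<Rightarrow> real ^ 'n \<Rightarrow> real ^ 'n" and \<Gamma> :: "real ^ 'n \<Rightarrow> real ^ 'n \<Rightarrow> real ^ 'n \<Rightarrow> real ^ 'n"
  assumes open_S: "open S"
    and g_smooth: "smooth_on S (\<lambda>x. g x v w)" and J_smooth: "smooth_on S (\<lambda>x. J x v)"
    and \<Gamma>_smooth: "smooth_on S (\<lambda>x. \<Gamma> x v w)"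
    and hermitian: "x \<in> S \<Longrightarrow> hermitian_form (g x) (J x)"
    and \<Gamma>_bilinear: "x \<in> S \<Longrightarrow> bilinear (\<Gamma> x)" and \<Gamma>_sym: "x \<in> S \<Longrightarrow> \<Gamma> x v w = \<Gamma> x w v"
    and \<Gamma>_metric: "x \<in> S \<Longrightarrow> der (\<lambda>y. g y v w) x u = g x (\<Gamma> x u v) w + g x v (\<Gamma> x u w)"
    and nk: "x \<in> S \<Longrightarrow> der (\<lambda>y. J y v) x v + \<Gamma> x v (J x v) - J x (\<Gamma> x v v) = 0"
begin

definition N :: "real ^ 'n \<Rightarrow> real ^ 'n \<Rightarrow> real ^ 'n \<Rightarrow> real ^ 'n" where
  "N x v w = der (\<lambda>y. J y w) x v + \<Gamma> x v (J x w) - J x (\<Gamma> x v w)"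

text \<open>Covariant derivative of the tensor \<open>N\<close>: the two subtracted terms compensate
  for extending \<open>v\<close> and \<open>w\<close> with constant components.\<close>

definition B :: "real ^ 'n \<Rightarrow> real ^ 'n \<Rightarrow> real ^ 'n \<Rightarrow> real ^ 'n \<Rightarrow> real ^ 'n" where
  "B x a v w = der (\<lambda>y. N y v w) x a + \<Gamma> x a (N x v w) - N x (\<Gamma> x a v) w - N x v (\<Gamma> x a w)"

text \<open>Curvature evaluated on the coordinate fields \<open>a\<close> and \<open>b\<close>;
  these commute, so there is no bracket term.\<close>

definition R :: "real ^ 'n \<Rightarrow> real ^ 'n \<Rightarrow> real ^ 'n \<Rightarrow> real ^ 'n \<Rightarrow> real ^ 'n" where
  "R x a b w = der (\<lambda>y. \<Gamma> y b w) x a - der (\<lambda>y. \<Gamma> y a w) x b + \<Gamma> x a (\<Gamma> x b w) - \<Gamma> x b (\<Gamma> x a w)"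

lemma \<Gamma>_linear: "x \<in> S \<Longrightarrow> linear (\<Gamma> x v)" "x \<in> S \<Longrightarrow> linear (\<lambda>v. \<Gamma> x v w)"
  using \<Gamma>_bilinear by (auto simp: bilinear_def)

lemma \<Gamma>_simps:
  assumes "x \<in> S"
  shows "\<Gamma> x (v + v') w = \<Gamma> x v w + \<Gamma> x v' w" "\<Gamma> x v (w + w') = \<Gamma> x v w + \<Gamma> x v w'"
    "\<Gamma> x v (w - w') = \<Gamma> x v w - \<Gamma> x v w'" "\<Gamma> x v (- w) = - \<Gamma> x v w"
    "\<Gamma> x (r *\<^sub>R v) w = r *\<^sub>R \<Gamma> x v w" "\<Gamma> x v (r *\<^sub>R w) = r *\<^sub>R \<Gamma> x v w"
  using \<Gamma>_bilinear[OF assms]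
  by (simp_all add: bilinear_ladd bilinear_radd bilinear_rneg bilinear_rsub bilinear_lmul bilinear_rmul)

lemma J_lin: "x \<in> S \<Longrightarrow> linear (J x)"
  using hermitian by (simp add: hermitian_form_def hermitian_form_axioms_def)

lemma g_bilinear: "x \<in> S \<Longrightarrow> bilinear (g x)"
  using hermitian by (simp add: hermitian_form_def inner_form_def)

lemma der_\<Gamma>:
  assumes "x \<in> S" "f differentiable (at t)" "f t = x" "V differentiable (at t)" "W differentiable (at t)"
  shows "((\<lambda>y. \<Gamma> (f y) (V y) (W y)) has_derivative
    (\<lambda>h. der (\<lambda>y. \<Gamma> y (V t) (W t)) x (der f t h) + \<Gamma> x (der V t h) (W t) + \<Gamma> x (V t) (der W t h))) (at t)"
  using has_derivative_bilinear_family_along[OF open_S _ \<Gamma>_bilinear smooth_on_differentiable[OF \<Gamma>_smooth], of f t V W]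
    assms by simp

lemma der_J:
  assumes "x \<in> S" "f differentiable (at t)" "f t = x" "V differentiable (at t)"
  shows "((\<lambda>y. J (f y) (V y)) has_derivative (\<lambda>h. der (\<lambda>y. J y (V t)) x (der f t h) + J x (der V t h))) (at t)"
  using has_derivative_linear_family_along[OF open_S _ J_lin smooth_on_differentiable[OF J_smooth], of f t V]
    assms by simp

lemma N_differentiable: "x \<in> S \<Longrightarrow> (\<lambda>y. N y v w) differentiable (at x)"
proof -
  assume x: "x \<in> S"
  have J: "(\<lambda>y. J y w) differentiable (at x)" and DJ: "(\<lambda>y. der (\<lambda>y. J y w) y v) differentiable (at x)"
    and G: "(\<lambda>y. \<Gamma> y v w) differentiable (at x)"
    using x by (auto intro: smooth_on_differentiable smooth_on_der J_smooth \<Gamma>_smooth)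
  have "(\<lambda>y. \<Gamma> y v (J y w)) differentiable (at x)"
    by (rule differentiableI[OF der_\<Gamma>[OF x differentiable_ident refl differentiable_const J]])
  moreover have "(\<lambda>y. J y (\<Gamma> y v w)) differentiable (at x)"
    by (rule differentiableI[OF der_J[OF x differentiable_ident refl G]])
  ultimately show ?thesis
    unfolding N_def using DJ by (intro differentiable_diff differentiable_add) auto
qed

lemma N_bilinear: "x \<in> S \<Longrightarrow> bilinear (N x)"
proof -
  assume x: "x \<in> S"
  have J: "(\<lambda>y. J y w) differentiable (at x)" for w
    by (rule smooth_on_differentiable[OF J_smooth x])
  note l = linear_add[OF J_lin[OF x]] linear_cmul[OF J_lin[OF x]] \<Gamma>_simps[OF x]
    linear_add[OF linear_der[OF J]] linear_cmul[OF linear_der[OF J]]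
    linear_add[OF linear_der_family[OF open_S x J_lin J]] linear_cmul[OF linear_der_family[OF open_S x J_lin J]]
  show ?thesis
    unfolding bilinear_def N_def by (auto intro!: linearI simp: l algebra_simps)
qed

text \<open>First of three product rules for the pull-back connection. They serve twice: along the
  immersion, and with \<open>f\<close> the identity for fields on the chart.\<close>

lemma along_J:
  assumes "x \<in> S" "f differentiable (at t)" "f t = x" "V differentiable (at t)"
  shows "(\<lambda>y. J (f y) (V y)) differentiable (at t)"
    and "cov_along \<Gamma> f t u (\<lambda>y. J (f y) (V y)) = N x (der f t u) (V t) + J x (cov_along \<Gamma> f t u V)"
proof -
  note d = der_J[OF assms]
  show "(\<lambda>y. J (f y) (V y)) differentiable (at t)" using d differentiable_def by blast
  show "cov_along \<Gamma> f t u (\<lambda>y. J (f y) (V y)) = N x (der f t u) (V t) + J x (cov_along \<Gamma> f t u V)"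
    using assms by (simp add: cov_along_def der_eqI[OF d] N_def linear_add[OF J_lin])
qed

lemma along_N:
  assumes "x \<in> S" "f differentiable (at t)" "f t = x" "V differentiable (at t)" "W differentiable (at t)"
  shows "(\<lambda>y. N (f y) (V y) (W y)) differentiable (at t)"
    and "cov_along \<Gamma> f t u (\<lambda>y. N (f y) (V y) (W y)) =
      B x (der f t u) (V t) (W t) + N x (cov_along \<Gamma> f t u V) (W t) + N x (V t) (cov_along \<Gamma> f t u W)"
proof -
  have d: "((\<lambda>y. N (f y) (V y) (W y)) has_derivative
    (\<lambda>h. der (\<lambda>y. N y (V t) (W t)) x (der f t h) + N x (der V t h) (W t) + N x (V t) (der W t h))) (at t)"
    using has_derivative_bilinear_family_along[OF open_S _ N_bilinear N_differentiable, of f t V W]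
      assms by simp
  show "(\<lambda>y. N (f y) (V y) (W y)) differentiable (at t)" using d differentiable_def by blast
  show "cov_along \<Gamma> f t u (\<lambda>y. N (f y) (V y) (W y)) =
      B x (der f t u) (V t) (W t) + N x (cov_along \<Gamma> f t u V) (W t) + N x (V t) (cov_along \<Gamma> f t u W)"
    using assms
    by (simp add: cov_along_def der_eqI[OF d] B_def bilinear_ladd[OF N_bilinear] bilinear_radd[OF N_bilinear])
qed

lemma along_g:
  assumes "x \<in> S" "f differentiable (at t)" "f t = x" "V differentiable (at t)" "W differentiable (at t)"
  shows "(\<lambda>y. g (f y) (V y) (W y)) differentiable (at t)"
    and "der (\<lambda>y. g (f y) (V y) (W y)) t u =
      g x (cov_along \<Gamma> f t u V) (W t) + g x (V t) (cov_along \<Gamma> f t u W)"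
proof -
  have d: "((\<lambda>y. g (f y) (V y) (W y)) has_derivative
    (\<lambda>h. der (\<lambda>y. g y (V t) (W t)) x (der f t h) + g x (der V t h) (W t) + g x (V t) (der W t h))) (at t)"
    using has_derivative_bilinear_family_along[OF open_S _ g_bilinear smooth_on_differentiable[OF g_smooth], of f t V W]
      assms by simp
  show "(\<lambda>y. g (f y) (V y) (W y)) differentiable (at t)" using d differentiable_def by blast
  show "der (\<lambda>y. g (f y) (V y) (W y)) t u =
      g x (cov_along \<Gamma> f t u V) (W t) + g x (V t) (cov_along \<Gamma> f t u W)"
    using assms
    by (simp add: cov_along_def der_eqI[OF d] \<Gamma>_metric bilinear_ladd[OF g_bilinear] bilinear_radd[OF g_bilinear])
qed

abbreviation "nabla x a W \<equiv> cov_along \<Gamma> (\<lambda>y. y) x a W"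

lemma nabla_const: "nabla x a (\<lambda>y. w) = \<Gamma> x a w"
  by (simp add: cov_along_def)

lemma nabla_cong: "x \<in> S \<Longrightarrow> (\<And>y. y \<in> S \<Longrightarrow> V y = W y) \<Longrightarrow> nabla x a V = nabla x a W"
  using der_cong_open[OF open_S, of x V W] by (simp add: cov_along_def)

lemma nabla_minus: "x \<in> S \<Longrightarrow> V differentiable (at x) \<Longrightarrow> nabla x a (\<lambda>y. - V y) = - nabla x a V"
  by (simp add: cov_along_def der_minus \<Gamma>_simps)

lemma nabla_add: "x \<in> S \<Longrightarrow> V differentiable (at x) \<Longrightarrow> W differentiable (at x) \<Longrightarrow>
    nabla x a (\<lambda>y. V y + W y) = nabla x a V + nabla x a W"
  by (simp add: cov_along_def der_add \<Gamma>_simps)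

lemma nabla_J:
  "x \<in> S \<Longrightarrow> V differentiable (at x) \<Longrightarrow> (\<lambda>y. J y (V y)) differentiable (at x)"
  "x \<in> S \<Longrightarrow> V differentiable (at x) \<Longrightarrow> nabla x a (\<lambda>y. J y (V y)) = N x a (V x) + J x (nabla x a V)"
  using along_J[of x "\<lambda>y. y" x V] by auto

lemma nabla_N:
  "x \<in> S \<Longrightarrow> V differentiable (at x) \<Longrightarrow> W differentiable (at x) \<Longrightarrow> (\<lambda>y. N y (V y) (W y)) differentiable (at x)"
  "x \<in> S \<Longrightarrow> V differentiable (at x) \<Longrightarrow> W differentiable (at x) \<Longrightarrow>
    nabla x a (\<lambda>y. N y (V y) (W y)) = B x a (V x) (W x) + N x (nabla x a V) (W x) + N x (V x) (nabla x a W)"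
  using along_N[of x "\<lambda>y. y" x V W] by auto

lemma der_g:
  "x \<in> S \<Longrightarrow> V differentiable (at x) \<Longrightarrow> W differentiable (at x) \<Longrightarrow> (\<lambda>y. g y (V y) (W y)) differentiable (at x)"
  "x \<in> S \<Longrightarrow> V differentiable (at x) \<Longrightarrow> W differentiable (at x) \<Longrightarrow>
    der (\<lambda>y. g y (V y) (W y)) x a = g x (nabla x a V) (W x) + g x (V x) (nabla x a W)"
  using along_g[of x "\<lambda>y. y" x V W] by auto

lemma \<Gamma>_differentiable: "x \<in> S \<Longrightarrow> (\<lambda>y. \<Gamma> y v w) differentiable (at x)"
  by (rule smooth_on_differentiable[OF \<Gamma>_smooth])

text \<open>The mixed second derivatives of \<open>W\<close> cancel by symmetry, and so do the cross
  terms of \<open>\<Gamma>\<close> with first derivatives. Nonconstant \<open>W\<close> is allowed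
  because the Ricci identity needs the field \<open>J y v\<close>.\<close>

lemma nabla_nabla:
  assumes x: "x \<in> S" and W: "smooth_on S W"
  shows "nabla x a (\<lambda>y. nabla y b W) - nabla x b (\<lambda>y. nabla y a W) = R x a b (W x)"
proof -
  have dW: "W differentiable (at x)" and ddW: "(\<lambda>y. der W y v) differentiable (at x)" for v
    using x by (auto intro: smooth_on_differentiable smooth_on_der W)
  have G: "((\<lambda>y. \<Gamma> y b (W y)) has_derivative
      (\<lambda>h. der (\<lambda>y. \<Gamma> y b (W x)) x h + \<Gamma> x b (der W x h))) (at x)" for b
    using der_\<Gamma>[OF x, of "\<lambda>y. y" x "\<lambda>y. b" W] dW \<Gamma>_bilinear[OF x] by (simp add: bilinear_lzero)
  have "nabla x a (\<lambda>y. nabla y b W) = der (\<lambda>y. der W y b) x a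
      + (der (\<lambda>y. \<Gamma> y b (W x)) x a + \<Gamma> x b (der W x a)) + \<Gamma> x a (der W x b) + \<Gamma> x a (\<Gamma> x b (W x))" for a b
    using ddW G differentiable_def x
    by (simp add: cov_along_def der_eqI[OF has_derivative_add[OF der_works[OF ddW] G]] \<Gamma>_simps)
  then show ?thesis
    using der_der_commute[OF W open_S x, of a b] by (simp add: R_def)
qed

text \<open>Obtained by differentiating the algebraic identities of \<open>J\<close>:
  \<open>J (J w) = - w\<close> gives anticommutation with \<open>N\<close>, and skewness of
  \<open>J\<close> gives skewness of \<open>N\<close>.\<close>

lemma nk_tensors: assumes x: "x \<in> S" shows "nk_tensors (g x) (J x) (N x)"
proof -
  interpret h: hermitian_form "g x" "J x" by (rule hermitian[OF x])
  have hy: "J y (J y w) = - w" "g y (J y v) w = - g y v (J y w)" if "y \<in> S" for y v w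
    using hermitian_form.J_J[OF hermitian[OF that]] hermitian_form.G_J_left[OF hermitian[OF that]] by auto
  have dJ: "(\<lambda>y. J y w) differentiable (at x)" for w by (rule smooth_on_differentiable[OF J_smooth x])
  have nJ: "nabla x v (\<lambda>y. J y w) = N x v w + J x (\<Gamma> x v w)" for v w
    using nabla_J(2)[OF x, of "\<lambda>y. w" v] by (simp add: nabla_const)
  show ?thesis
  proof unfold_locales
    show "bilinear (N x)" by (rule N_bilinear[OF x])
    show "N x v v = 0" for v unfolding N_def by (rule nk[OF x])
    show "N x v (J x w) = - J x (N x v w)" for v w
    proof -
      have "nabla x v (\<lambda>y. J y (J y w)) = nabla x v (\<lambda>y. - w)"
        by (rule nabla_cong[OF x hy(1)])
      moreover have "nabla x v (\<lambda>y. J y (J y w)) = N x v (J x w) + J x (N x v w + J x (\<Gamma> x v w))"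
        using nabla_J(2)[OF x dJ] nJ by simp
      ultimately show ?thesis
        by (simp add: nabla_const \<Gamma>_simps x eq_neg_iff_add_eq_0)
    qed
    show "g x (N x u v) w = - g x v (N x u w)" for u v w
    proof -
      have "der (\<lambda>y. g y (J y v) w) x u = der (\<lambda>y. - g y v (J y w)) x u"
        by (rule fun_cong[OF der_cong_open[OF open_S x hy(2)]])
      also have "\<dots> = - der (\<lambda>y. g y v (J y w)) x u"
        by (rule der_minus) (intro der_g x dJ differentiable_const)
      finally show ?thesis
        using der_g(2)[OF x dJ, of "\<lambda>y. w"] der_g(2)[OF x _ dJ, of "\<lambda>y. v"]
        by (simp add: nJ nabla_const h.G_J_left)
    qed
  qed
qed

lemma nk_curvature_tensors: assumes x: "x \<in> S" shows "nk_curvature_tensors (g x) (J x) (N x) (B x) (R x)"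
proof -
  interpret h: nk_tensors "g x" "J x" "N x" by (rule nk_tensors[OF x])
  have dJ: "(\<lambda>y. J y w) differentiable (at x)" for w by (rule smooth_on_differentiable[OF J_smooth x])
  have dN: "(\<lambda>y. N y v w) differentiable (at x)" for v w by (rule N_differentiable[OF x])
  have nJ: "nabla x v (\<lambda>y. J y w) = N x v w + J x (\<Gamma> x v w)" if "x \<in> S" for v w x
    using nabla_J(2)[OF that, of "\<lambda>y. w" v] by (simp add: nabla_const)
  have nN: "nabla x a (\<lambda>y. N y v w) = B x a v w + N x (\<Gamma> x a v) w + N x v (\<Gamma> x a w)" for a v w
    using nabla_N(2)[OF x, of "\<lambda>y. v" "\<lambda>y. w" a] by (simp add: nabla_const)
  have nn: "nabla x a (\<lambda>y. \<Gamma> y b w) - nabla x b (\<lambda>y. \<Gamma> y a w) = R x a b w" for a b w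
    using nabla_nabla[OF x smooth_on_const, of a b w] by (simp add: nabla_const)
  show ?thesis
  proof unfold_locales
    show "B x a u v = - B x a v u" for a u v
    proof -
      have "nabla x a (\<lambda>y. N y u v) = nabla x a (\<lambda>y. - N y v u)"
        by (rule nabla_cong[OF x nk_tensors.N_skew[OF nk_tensors]])
      also have "\<dots> = - nabla x a (\<lambda>y. N y v u)" by (rule nabla_minus[OF x dN])
      finally have "B x a u v + N x (\<Gamma> x a u) v + N x u (\<Gamma> x a v) =
        - (B x a v u + N x (\<Gamma> x a v) u + N x v (\<Gamma> x a u))" by (simp only: nN)
      then show ?thesis
        using h.N_skew[of "\<Gamma> x a u" v] h.N_skew[of u "\<Gamma> x a v"] by (simp add: algebra_simps)
    qed
    show "g x (B x a u v) w = - g x v (B x a u w)" for a u v w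
    proof -
      have "der (\<lambda>y. g y (N y u v) w) x a = der (\<lambda>y. - g y v (N y u w)) x a"
        by (rule fun_cong[OF der_cong_open[OF open_S x nk_tensors.N_G[OF nk_tensors]]])
      also have "\<dots> = - der (\<lambda>y. g y v (N y u w)) x a"
        by (rule der_minus) (intro der_g x dN differentiable_const)
      finally show ?thesis
        using der_g(2)[OF x dN, of "\<lambda>y. w"] der_g(2)[OF x _ dN, of "\<lambda>y. v"]
        by (simp add: nN nabla_const h.N_G)
    qed
    show "B x a u (J x v) = - J x (B x a u v) - N x u (N x a v) - N x a (N x u v)" for a u v
    proof -
      have "nabla x a (\<lambda>y. N y u (J y v)) = nabla x a (\<lambda>y. - J y (N y u v))"
        by (rule nabla_cong[OF x nk_tensors.N_J[OF nk_tensors]])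
      also have "\<dots> = - nabla x a (\<lambda>y. J y (N y u v))"
        by (intro nabla_minus nabla_J x dN)
      also have "\<dots> = - (N x a (N x u v) + J x (B x a u v + N x (\<Gamma> x a u) v + N x u (\<Gamma> x a v)))"
        by (simp only: nabla_J(2)[OF x dN] nN)
      finally show ?thesis
        using nabla_N(2)[OF x differentiable_const dJ, of a u v] by (simp add: nabla_const nJ x algebra_simps)
    qed
    show "R x a b v = - R x b a v" for a b v by (simp add: R_def)
    show "R x a b c + R x b c a + R x c a b = 0" for a b c
    proof -
      \<comment> \<open>With \<open>\<Gamma>\<close> symmetric, the six terms of the cyclic
        curvature sum cancel in pairs.\<close>
      have "nabla x a (\<lambda>y. \<Gamma> y b c) = nabla x a (\<lambda>y. \<Gamma> y c b)" for a b c
        by (rule nabla_cong[OF x \<Gamma>_sym])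
      then show ?thesis unfolding nn[symmetric] by (simp add: algebra_simps)
    qed
    show "g x (R x a b v) w = - g x v (R x a b w)" for a b v w
    proof -
      have "der (\<lambda>y. der (\<lambda>y. g y v w) y b) x a =
          g x (nabla x a (\<lambda>y. \<Gamma> y b v)) w + g x (\<Gamma> x b v) (\<Gamma> x a w)
          + (g x (\<Gamma> x a v) (\<Gamma> x b w) + g x v (nabla x a (\<lambda>y. \<Gamma> y b w)))" for a b
      proof -
        have "der (\<lambda>y. der (\<lambda>y. g y v w) y b) x a =
          der (\<lambda>y. g y (\<Gamma> y b v) w + g y v (\<Gamma> y b w)) x a"
          by (rule fun_cong[OF der_cong_open[OF open_S x \<Gamma>_metric]])
        also have "\<dots> = der (\<lambda>y. g y (\<Gamma> y b v) w) x a + der (\<lambda>y. g y v (\<Gamma> y b w)) x a"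
          by (rule der_add) (intro der_g x \<Gamma>_differentiable differentiable_const)+
        finally show ?thesis
          using der_g(2)[OF x \<Gamma>_differentiable[OF x], of "\<lambda>y. w"] der_g(2)[OF x _ \<Gamma>_differentiable[OF x], of "\<lambda>y. v"]
          by (simp add: nabla_const)
      qed
      \<comment> \<open>Second derivatives of the function \<open>g y v w\<close> commute, and the
        products of two Christoffel terms are symmetric in \<open>a\<close> and \<open>b\<close>;
        only the curvature terms remain in the difference.\<close>
      from this[of a b] this[of b a] show ?thesis
        using der_der_commute[OF g_smooth open_S x, of v w a b]
        unfolding nn[symmetric] by simp
    qed
    show "R x a b (J x v) - J x (R x a b v) = B x a b v - B x b a v" for a b v
    proof -
      have "nabla x a (\<lambda>y. nabla y b (\<lambda>z. J z v)) =
         B x a b v + N x (\<Gamma> x a b) v + N x b (\<Gamma> x a v) + N x a (\<Gamma> x b v) + J x (nabla x a (\<lambda>y. \<Gamma> y b v))" for a b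
      proof -
        have "nabla x a (\<lambda>y. nabla y b (\<lambda>z. J z v)) = nabla x a (\<lambda>y. N y b v + J y (\<Gamma> y b v))"
          by (rule nabla_cong[OF x nJ])
        also have "\<dots> = nabla x a (\<lambda>y. N y b v) + nabla x a (\<lambda>y. J y (\<Gamma> y b v))"
          by (intro nabla_add nabla_J x dN \<Gamma>_differentiable)
        finally show ?thesis by (simp add: nN nabla_J(2)[OF x \<Gamma>_differentiable[OF x]])
      qed
      \<comment> \<open>Antisymmetrising in \<open>a\<close> and \<open>b\<close> removes
        \<open>N x (\<Gamma> x a b) v\<close>, as the connection is torsion-free, and the symmetric
        sum of the other two mixed terms.\<close>
      then show ?thesis
        using nabla_nabla[OF x J_smooth, of a b v] \<Gamma>_sym[OF x, of a b]
        unfolding nn[symmetric] by (simp add: algebra_simps)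
    qed
  qed
qed

end

section \<open>Lagrangian immersions in a chart\<close>

lemma normal_part_eqI:
  assumes "inner_form G" "subspace V" "w - n \<in> V" "\<And>s. s \<in> V \<Longrightarrow> G n s = 0"
  shows "normal_part G V w = n"
  unfolding normal_part_def
proof (rule the_equality)
  interpret inner_form G by fact
  show "w - n \<in> V \<and> (\<forall>s\<in>V. G n s = 0)" using assms by blast
  fix n' assume n': "w - n' \<in> V \<and> (\<forall>s\<in>V. G n' s = 0)"
  \<comment> \<open>Uniqueness: the difference of two candidates lies in \<open>V\<close> and is
    orthogonal to \<open>V\<close>.\<close>
  have "n' - n = (w - n) - (w - n')" by simp
  then have "n' - n \<in> V" using subspace_diff[OF assms(2,3)] n' by metis
  then have "G (n' - n) (n' - n) = 0" using assms(4) n' by (metis G_simps(3) diff_self)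
  then show "n' = n" using G_pos[of "n' - n"] by force
qed

lemma matrix_inv_eqI:
  fixes A X :: "real ^ 'k::finite ^ 'k"
  assumes "A ** X = mat 1"
  shows "matrix_inv A = X"
proof -
  have XA: "X ** A = mat 1" using assms matrix_left_right_inverse by blast
  have "A ** matrix_inv A = mat 1 \<and> matrix_inv A ** A = mat 1"
    unfolding matrix_inv_def by (rule someI[of _ X]) (use assms XA in blast)
  then show ?thesis
    using XA by (metis matrix_mul_assoc matrix_mul_lid matrix_mul_rid)
qed

lemma vec_expansion_3:
  fixes v :: "real ^ 'k::finite"
  assumes "(UNIV :: 'k set) = {k1, k2, k3}" "k1 \<noteq> k2" "k1 \<noteq> k3" "k2 \<noteq> k3"
  shows "v = v $ k1 *\<^sub>R axis k1 1 + v $ k2 *\<^sub>R axis k2 1 + v $ k3 *\<^sub>R axis k3 1"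
proof -
  have "i = k1 \<or> i = k2 \<or> i = k3" for i using assms(1) by blast
  then show ?thesis using assms(2-4) by (auto simp: vec_eq_iff axis_def)
qed

text \<open>The index type is any type with three elements, so its elements are named
  explicitly.\<close>

lemma det_card_3:
  fixes A :: "real ^ 'k::finite ^ 'k"
  assumes U: "(UNIV :: 'k set) = {k1, k2, k3}" and ne: "k1 \<noteq> k2" "k1 \<noteq> k3" "k2 \<noteq> k3"
  shows "det A =
    A$k1$k1 * A$k2$k2 * A$k3$k3 + A$k1$k2 * A$k2$k3 * A$k3$k1 + A$k1$k3 * A$k2$k1 * A$k3$k2 -
    A$k1$k1 * A$k2$k3 * A$k3$k2 - A$k1$k2 * A$k2$k1 * A$k3$k3 - A$k1$k3 * A$k2$k2 * A$k3$k1"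
proof -
  have f123: "finite {k2, k3}" "k1 \<notin> {k2, k3}" and f23: "finite {k3}" "k2 \<notin> {k3}"
    using ne by auto
  show ?thesis
    unfolding det_def U
    unfolding sum_over_permutations_insert[OF f123]
    unfolding sum_over_permutations_insert[OF f23]
    unfolding permutes_sing
    using ne
    by (simp add: sign_swap_id permutation_swap_id sign_compose sign_id swap_id_eq transpose_def)
qed

text \<open>After expansion in the axes only the six permutations survive. This is used twice: to
  pass from an orthonormal basis to the coordinate basis, and to read off the sign of a
  Jacobian.\<close>

lemma alternating_3_det:
  fixes \<phi> :: "real ^ 'k::finite \<Rightarrow> real ^ 'k \<Rightarrow> real ^ 'k \<Rightarrow> real" and L :: "real ^ 'k \<Rightarrow> real ^ 'k"
  assumes U: "(UNIV :: 'k set) = {k1, k2, k3}" and ne: "k1 \<noteq> k2" "k1 \<noteq> k3" "k2 \<noteq> k3"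
    and lin: "\<And>v w. linear (\<lambda>u. \<phi> u v w)" "\<And>u w. linear (\<lambda>v. \<phi> u v w)" "\<And>u v. linear (\<lambda>w. \<phi> u v w)"
    and alt: "\<And>u v w. \<phi> u v w = - \<phi> v u w" "\<And>u v w. \<phi> u v w = - \<phi> u w v"
  shows "\<phi> (L (axis k1 1)) (L (axis k2 1)) (L (axis k3 1)) =
    det (matrix L) * \<phi> (axis k1 1) (axis k2 1) (axis k3 1)"
proof -
  let ?e1 = "axis k1 1 :: real ^ 'k" and ?e2 = "axis k2 1 :: real ^ 'k" and ?e3 = "axis k3 1 :: real ^ 'k"
  define A where "A = matrix L"
  have L: "L (axis k 1) = A $ k1 $ k *\<^sub>R ?e1 + A $ k2 $ k *\<^sub>R ?e2 + A $ k3 $ k *\<^sub>R ?e3" for k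
    by (subst vec_expansion_3[OF U ne, of "L (axis k 1)"]) (simp add: A_def matrix_def)
  note s = linear_add[OF lin(1)] linear_add[OF lin(2)] linear_add[OF lin(3)]
    linear_cmul[OF lin(1)] linear_cmul[OF lin(2)] linear_cmul[OF lin(3)]
  have z: "\<phi> u u w = 0" "\<phi> u w w = 0" "\<phi> u w u = 0" for u w
    using alt(1)[of u u w] alt(2)[of u w w] alt(1)[of u w u] alt(2)[of w u u] by simp_all
  have p: "\<phi> ?e1 ?e3 ?e2 = - \<phi> ?e1 ?e2 ?e3" "\<phi> ?e2 ?e1 ?e3 = - \<phi> ?e1 ?e2 ?e3" "\<phi> ?e2 ?e3 ?e1 = \<phi> ?e1 ?e2 ?e3"
     "\<phi> ?e3 ?e1 ?e2 = \<phi> ?e1 ?e2 ?e3" "\<phi> ?e3 ?e2 ?e1 = - \<phi> ?e1 ?e2 ?e3"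
    using alt(2)[of ?e1 ?e3 ?e2] alt(1)[of ?e2 ?e1 ?e3] alt(2)[of ?e2 ?e3 ?e1] alt(1)[of ?e3 ?e1 ?e2]
      alt(1)[of ?e3 ?e2 ?e1] by simp_all
  have "\<phi> (L ?e1) (L ?e2) (L ?e3) = det A * \<phi> ?e1 ?e2 ?e3"
    unfolding L s det_card_3[OF U ne] by (simp add: z p) (simp add: algebra_simps)
  then show ?thesis by (simp add: A_def)
qed

section \<open>Second fundamental form of a Lagrangian patch\<close>

locale lagrangian_patch = nk_chart S g J \<Gamma>
  for S :: "(real ^ 'n::finite) set" and g J \<Gamma> +
  fixes U :: "(real ^ 'k::finite) set" and f :: "real ^ 'k \<Rightarrow> real ^ 'n"
  assumes open_U: "open U" and f_smooth: "smooth_on U f" and f_S: "x \<in> U \<Longrightarrow> f x \<in> S"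
    and f_inj: "x \<in> U \<Longrightarrow> inj (der f x)"
    and isotropic: "x \<in> U \<Longrightarrow> g (f x) (J (f x) (der f x u)) (der f x v) = 0"
    and dim_n: "CARD('n) = 6" and dim_k: "CARD('k) = 3"
    and strict: "y \<in> S \<Longrightarrow> z \<noteq> 0 \<Longrightarrow> \<exists>z'. N y z z' \<noteq> 0"
begin

definition P :: "real ^ 'k \<Rightarrow> real ^ 'k \<Rightarrow> real ^ 'k \<Rightarrow> real ^ 'n" where
  "P x u v = cov_along \<Gamma> f x u (\<lambda>y. der f y v)"

text \<open>\<open>P\<close> still contains a tangential part, but \<open>J\<close> maps tangent
  vectors to normal ones, so only the second fundamental form contributes here.\<close>

definition cubic :: "real ^ 'k \<Rightarrow> real ^ 'k \<Rightarrow> real ^ 'k \<Rightarrow> real ^ 'k \<Rightarrow> real" where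
  "cubic x u v w = g (f x) (J (f x) (P x u v)) (der f x w)"

definition first_form :: "real ^ 'k \<Rightarrow> real ^ 'k \<Rightarrow> real ^ 'k \<Rightarrow> real" where
  "first_form x u v = g (f x) (der f x u) (der f x v)"

definition vol :: "real ^ 'k \<Rightarrow> real ^ 'k \<Rightarrow> real ^ 'k \<Rightarrow> real ^ 'k \<Rightarrow> real" where
  "vol x u v w = g (f x) (N (f x) (der f x u) (der f x v)) (J (f x) (der f x w))"

lemma f_diff: "x \<in> U \<Longrightarrow> f differentiable (at x)" "x \<in> U \<Longrightarrow> (\<lambda>y. der f y v) differentiable (at x)"
  using f_smooth smooth_on_differentiable smooth_on_der by blast+

lemma df_linear: "x \<in> U \<Longrightarrow> linear (der f x)"
  by (rule linear_der[OF f_diff(1)])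

lemma P_sym: "x \<in> U \<Longrightarrow> P x u v = P x v u"
  unfolding P_def cov_along_def
  using der_der_commute[OF f_smooth open_U, of x v u] \<Gamma>_sym[OF f_S] by simp

lemma P_linear:
  assumes x: "x \<in> U"
  shows "linear (\<lambda>u. P x u v)" "linear (P x u)"
proof -
  note l = linear_add[OF linear_der[OF f_diff(2)[OF x]]] linear_cmul[OF linear_der[OF f_diff(2)[OF x]]]
    linear_add[OF df_linear[OF x]] linear_cmul[OF df_linear[OF x]] \<Gamma>_simps[OF f_S[OF x]]
  show *: "linear (\<lambda>u. P x u v)" for v
    unfolding P_def cov_along_def by (rule linearI) (simp_all add: l algebra_simps)
  have "P x u = (\<lambda>v. P x v u)" using P_sym[OF x] by auto
  then show "linear (P x u)" using * by metis
qed

lemma nk_tensors_f: "x \<in> U \<Longrightarrow> nk_tensors (g (f x)) (J (f x)) (N (f x))"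
  and nk_curvature_tensors_f: "x \<in> U \<Longrightarrow> nk_curvature_tensors (g (f x)) (J (f x)) (N (f x)) (B (f x)) (R (f x))"
  using nk_tensors nk_curvature_tensors f_S by blast+

lemma cubic_swap12: "x \<in> U \<Longrightarrow> cubic x u v w = cubic x v u w"
  by (simp add: cubic_def P_sym)

text \<open>Differentiates the Lagrangian condition along \<open>u\<close>; cyclic summation then gives
  \<open>3 g ((\<nabla>\<^sub>u J) v) w = d\<omega> (u, v, w) = 0\<close>.\<close>

lemma der_isotropic:
  assumes x: "x \<in> U"
  shows "g (f x) (N (f x) (der f x u) (der f x v)) (der f x w) = cubic x u w v - cubic x u v w"
proof -
  interpret nk_tensors "g (f x)" "J (f x)" "N (f x)" by (rule nk_tensors_f[OF x])
  note fx = f_S[OF x] f_diff(1)[OF x] refl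
  have "der (\<lambda>y. g (f y) (J (f y) (der f y v)) (der f y w)) x u = der (\<lambda>y. 0) x u"
    by (rule fun_cong[OF der_cong_open[OF open_U x isotropic]])
  moreover have "der (\<lambda>y. g (f y) (J (f y) (der f y v)) (der f y w)) x u =
     g (f x) (N (f x) (der f x u) (der f x v) + J (f x) (P x u v)) (der f x w)
     + g (f x) (J (f x) (der f x v)) (P x u w)"
    unfolding P_def along_g(2)[OF fx along_J(1)[OF fx f_diff(2)[OF x]] f_diff(2)[OF x]]
      along_J(2)[OF fx f_diff(2)[OF x]] ..
  ultimately show ?thesis
    by (simp add: cubic_def G_J_left[of "der f x v"] G_sym[of "der f x v"])
qed

text \<open>The three cyclic instances of \<open>der_isotropic\<close> have the same left-hand side,
  by skewness of \<open>T\<close>; their right-hand sides cancel in pairs because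
  \<open>cubic\<close> is symmetric in its first two slots.\<close>

lemma N_tangent:
  assumes x: "x \<in> U"
  shows "g (f x) (N (f x) (der f x u) (der f x v)) (der f x w) = 0"
proof -
  interpret nk_tensors "g (f x)" "J (f x)" "N (f x)" by (rule nk_tensors_f[OF x])
  let ?T = "\<lambda>u v w. T (der f x u) (der f x v) (der f x w)"
  have "?T v w u = ?T u v w" "?T w u v = ?T u v w"
    using T_skew by (metis minus_minus)+
  then show ?thesis
    using der_isotropic[OF x, of u v w] der_isotropic[OF x, of v w u] der_isotropic[OF x, of w u v]
      cubic_swap12[OF x, of u v w] cubic_swap12[OF x, of u w v] cubic_swap12[OF x, of v w u]
    by (simp add: T_def)
qed

lemma cubic_swap23: "x \<in> U \<Longrightarrow> cubic x u v w = cubic x u w v"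
  using der_isotropic[of x u v w] N_tangent[of x u v w] by simp

lemma der_N_tangent:
  assumes x: "x \<in> U"
  shows "g (f x) (B (f x) (der f x u) (der f x a) (der f x b)) (der f x c)
    + g (f x) (N (f x) (P x u a) (der f x b)) (der f x c)
    + g (f x) (N (f x) (der f x a) (P x u b)) (der f x c)
    + g (f x) (N (f x) (der f x a) (der f x b)) (P x u c) = 0"
proof -
  interpret nk_tensors "g (f x)" "J (f x)" "N (f x)" by (rule nk_tensors_f[OF x])
  note fx = f_S[OF x] f_diff(1)[OF x] refl
  have "der (\<lambda>y. g (f y) (N (f y) (der f y a) (der f y b)) (der f y c)) x u = der (\<lambda>y. 0) x u"
    by (rule fun_cong[OF der_cong_open[OF open_U x N_tangent]])
  moreover have "der (\<lambda>y. g (f y) (N (f y) (der f y a) (der f y b)) (der f y c)) x u =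
     g (f x) (B (f x) (der f x u) (der f x a) (der f x b) + N (f x) (P x u a) (der f x b)
       + N (f x) (der f x a) (P x u b)) (der f x c)
     + g (f x) (N (f x) (der f x a) (der f x b)) (P x u c)"
    unfolding P_def along_g(2)[OF fx along_N(1)[OF fx f_diff(2)[OF x] f_diff(2)[OF x]] f_diff(2)[OF x]]
      along_N(2)[OF fx f_diff(2)[OF x] f_diff(2)[OF x]] ..
  ultimately show ?thesis by simp
qed

section \<open>Orthonormal tangent frames and the vanishing trace\<close>

lemma df_eq_0: "x \<in> U \<Longrightarrow> der f x u = 0 \<longleftrightarrow> u = 0"
  using f_inj df_linear linear_injective_0 by (metis linear_0)

lemma first_form: "x \<in> U \<Longrightarrow> inner_form (first_form x)"
proof -
  assume x: "x \<in> U"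
  interpret nk_tensors "g (f x)" "J (f x)" "N (f x)" by (rule nk_tensors_f[OF x])
  note l = linear_add[OF df_linear[OF x]] linear_cmul[OF df_linear[OF x]]
  show ?thesis
  proof
    show "bilinear (first_form x)"
      unfolding bilinear_def first_form_def by (auto intro!: linearI simp: l)
    show "first_form x v w = first_form x w v" for v w by (simp add: first_form_def G_sym)
    show "v \<noteq> 0 \<Longrightarrow> first_form x v v > 0" for v by (simp add: first_form_def G_pos df_eq_0 x)
  qed
qed

definition onb :: "real ^ 'k \<Rightarrow> real ^ 'k \<Rightarrow> real ^ 'k \<Rightarrow> real ^ 'k \<Rightarrow> bool" where
  "onb x w1 w2 w3 \<longleftrightarrow> first_form x w1 w1 = 1 \<and> first_form x w2 w2 = 1 \<and> first_form x w3 w3 = 1 \<and>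
     first_form x w1 w2 = 0 \<and> first_form x w1 w3 = 0 \<and> first_form x w2 w3 = 0"

lemma onb_exists: assumes "x \<in> U" obtains w1 w2 w3 where "onb x w1 w2 w3"
proof -
  have "DIM(real ^ 'k) \<ge> 3" using dim_k by simp
  then obtain w1 w2 w3 where "first_form x w1 w1 = 1" "first_form x w2 w2 = 1" "first_form x w3 w3 = 1"
    "first_form x w1 w2 = 0" "first_form x w1 w3 = 0" "first_form x w2 w3 = 0"
    by (rule inner_form.orthonormal_triple_exists[OF first_form[OF assms]])
  then show ?thesis using that unfolding onb_def by blast
qed

lemma onb_frame:
  assumes "x \<in> U" "onb x w1 w2 w3"
  shows "hermitian_form.lagrangian_frame (g (f x)) (J (f x)) (der f x w1) (der f x w2) (der f x w3)"
proof -
  interpret nk_tensors "g (f x)" "J (f x)" "N (f x)" by (rule nk_tensors_f[OF assms(1)])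
  show ?thesis
    using assms isotropic unfolding lagrangian_frame_def onb_def first_form_def by blast
qed

lemma onb_rotate: "x \<in> U \<Longrightarrow> onb x w1 w2 w3 \<Longrightarrow> onb x w2 w3 w1"
  unfolding onb_def using inner_form.G_sym[OF first_form] by metis

lemma dim_n': "DIM(real ^ 'n) = 6"
  using dim_n by simp

lemma vol_onb:
  assumes x: "x \<in> U" and w: "onb x w1 w2 w3"
  shows "vol x w1 w2 w3 \<noteq> 0"
proof -
  interpret nk_tensors "g (f x)" "J (f x)" "N (f x)" by (rule nk_tensors_f[OF x])
  have "der f x w1 \<noteq> 0"
    using w by (auto simp: onb_def first_form_def)
  then obtain w where w': "N (f x) (der f x w1) w \<noteq> 0" using strict f_S[OF x] by blast
  show ?thesis
    using T_frame_nonzero[OF onb_frame[OF x w] dim_n' _ w'] N_tangent[OF x]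
    by (simp add: T_def vol_def)
qed

lemma cubic_trace_onb:
  assumes x: "x \<in> U" and w: "onb x w1 w2 w3"
  shows "cubic x w1 w1 w1 + cubic x w1 w2 w2 + cubic x w1 w3 w3 = 0"
proof -
  interpret nk_curvature_tensors "g (f x)" "J (f x)" "N (f x)" "B (f x)" "R (f x)"
    by (rule nk_curvature_tensors_f[OF x])
  define e1 e2 e3 where e: "e1 = der f x w1" "e2 = der f x w2" "e3 = der f x w3"
  define p1 p2 p3 where p: "p1 = P x w1 w1" "p2 = P x w1 w2" "p3 = P x w1 w3"
  have fr: "lagrangian_frame e1 e2 e3" using onb_frame[OF x w] by (simp add: e)
  have T0: "T e1 e2 e3 = 0" using N_tangent[OF x] by (simp add: T_def e)
  have S0: "nabla_T e1 e1 e2 e3 + T p1 e2 e3 + T e1 p2 e3 + T e1 e2 p3 = 0"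
    using der_N_tangent[OF x, of w1 w1 w2 w3] by (simp add: nabla_T_def T_def e p)
  have "nabla_T e1 e1 e2 e3 = 0" by (rule nabla_T_frame[OF fr dim_n'])
  \<comment> \<open>Tangential components of \<open>p1\<close> give a repeated argument or
    \<open>T e1 e2 e3 = 0\<close>; those along \<open>J e2\<close> and \<open>J e3\<close> vanish
    since \<open>J\<close> can be moved to leave a repeated argument. Only \<open>J e1\<close>
    remains, and likewise \<open>J e2\<close> for \<open>p2\<close> and \<open>J e3\<close> for
    \<open>p3\<close>.\<close>
  moreover have "T p1 e2 e3 = g (f x) p1 (J (f x) e1) * T e1 e2 (J (f x) e3)"
    by (subst frame_expansion[OF fr dim_n', of p1]) (simp add: T0 T_J)
  moreover have "T e1 p2 e3 = g (f x) p2 (J (f x) e2) * T e1 e2 (J (f x) e3)"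
    by (subst frame_expansion[OF fr dim_n', of p2]) (simp add: T0 T_J)
  moreover have "T e1 e2 p3 = g (f x) p3 (J (f x) e3) * T e1 e2 (J (f x) e3)"
    by (subst frame_expansion[OF fr dim_n', of p3]) (simp add: T0 T_J)
  ultimately have "(g (f x) p1 (J (f x) e1) + g (f x) p2 (J (f x) e2) + g (f x) p3 (J (f x) e3))
      * T e1 e2 (J (f x) e3) = 0"
    using S0 by (simp add: algebra_simps)
  moreover have "T e1 e2 (J (f x) e3) \<noteq> 0"
    using vol_onb[OF x w] by (simp add: vol_def T_def e)
  ultimately show ?thesis
    by (simp add: cubic_def G_J_left flip: e p)
qed

text \<open>Total symmetry of \<open>cubic\<close> moves the free slot to the end, which turns the
  trace identity into a statement about one normal component of the trace of
  \<open>P\<close>.\<close>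

lemma trace_P_normal:
  assumes x: "x \<in> U" and w: "onb x w1 w2 w3"
  shows "g (f x) (P x w1 w1 + P x w2 w2 + P x w3 w3) (J (f x) (der f x w1)) = 0"
proof -
  interpret nk_tensors "g (f x)" "J (f x)" "N (f x)" by (rule nk_tensors_f[OF x])
  have "cubic x v v w1 = cubic x w1 v v" for v
    using cubic_swap12[OF x] cubic_swap23[OF x] by metis
  from this[of w2] this[of w3] have "cubic x w1 w1 w1 + cubic x w2 w2 w1 + cubic x w3 w3 w1 = 0"
    using cubic_trace_onb[OF x w] by simp
  then show ?thesis by (simp add: cubic_def G_J_left)
qed

lemma mean_curvature_0:
  assumes x: "x \<in> U"
  shows "(\<Sum>i\<in>UNIV. \<Sum>j\<in>UNIV. matrix_inv (\<chi> i j. first_form x (axis i 1) (axis j 1)) $ i $ j *\<^sub>R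
      normal_part (g (f x)) (range (der f x)) (P x (axis i 1) (axis j 1))) = 0"
proof -
  interpret nk_tensors "g (f x)" "J (f x)" "N (f x)" by (rule nk_tensors_f[OF x])
  interpret q: inner_form "first_form x" by (rule first_form[OF x])
  obtain w1 w2 w3 where w: "onb x w1 w2 w3" using onb_exists[OF x] .
  note w' = onb_rotate[OF x w] and w'' = onb_rotate[OF x onb_rotate[OF x w]]
  define e1 e2 e3 where e: "e1 = der f x w1" "e2 = der f x w2" "e3 = der f x w3"
  have fr: "lagrangian_frame e1 e2 e3" using onb_frame[OF x w] by (simp add: e)
  \<comment> \<open>The vectors \<open>J e1\<close>, \<open>J e2\<close>, \<open>J e3\<close> form
    an orthonormal basis of the normal space, so this is the orthogonal projection onto it.\<close>
  define nrm where "nrm = (\<lambda>p. g (f x) p (J (f x) e1) *\<^sub>R J (f x) e1 + g (f x) p (J (f x) e2) *\<^sub>R J (f x) e2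
     + g (f x) p (J (f x) e3) *\<^sub>R J (f x) e3)"
  have nrm_lin: "linear nrm" by (rule linearI) (simp_all add: nrm_def algebra_simps)
  have sub: "subspace (range (der f x))"
    using df_linear[OF x] linear_subspace_image subspace_UNIV by blast
  have np: "normal_part (g (f x)) (range (der f x)) p = nrm p" for p
  proof (rule normal_part_eqI[OF inner_form_axioms sub])
    have "p - nrm p = g (f x) p e1 *\<^sub>R e1 + g (f x) p e2 *\<^sub>R e2 + g (f x) p e3 *\<^sub>R e3"
      by (subst frame_expansion[OF fr dim_n', of p]) (simp add: nrm_def)
    also have "\<dots> \<in> range (der f x)"
      unfolding e by (intro subspace_add[OF sub] subspace_mul[OF sub]) auto
    finally show "p - nrm p \<in> range (der f x)" .
    show "g (f x) (nrm p) s = 0" if "s \<in> range (der f x)" for s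
      using that isotropic[OF x] by (auto simp: nrm_def e)
  qed
  \<comment> \<open>In coordinates the inverse Gram matrix is the sum of the squares (outer
    products) of the vectors of an orthonormal basis.\<close>
  define W where "W = (\<lambda>i j. w1 $ i * w1 $ j + w2 $ i * w2 $ j + w3 $ i * w3 $ j)"
  have expand: "v = first_form x v w1 *\<^sub>R w1 + first_form x v w2 *\<^sub>R w2 + first_form x v w3 *\<^sub>R w3" for v
  proof -
    have d: "w1 \<noteq> w2" "w1 \<noteq> w3" "w2 \<noteq> w3" using w by (auto simp: onb_def)
    have "v = (\<Sum>y\<in>{w1, w2, w3}. first_form x v y *\<^sub>R y)"
      by (rule q.orthonormal_expansion) (use w d dim_k q.G_sym in \<open>auto simp: onb_def\<close>)
    then show ?thesis using d by (simp add: add.assoc)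
  qed
  have inv: "matrix_inv (\<chi> i j. first_form x (axis i 1) (axis j 1)) = (\<chi> i j. W i j)"
  proof (rule matrix_inv_eqI)
    have "(\<Sum>k\<in>UNIV. first_form x (axis i 1) (axis k 1) * W k j) = (if i = j then 1 else 0)" for i j
    proof -
      have s: "(\<Sum>k\<in>UNIV. first_form x u (axis k 1) * v $ k) = first_form x u v" for u v
      proof -
        have "first_form x u (\<Sum>k\<in>UNIV. v $ k *\<^sub>R axis k 1) = (\<Sum>k\<in>UNIV. first_form x u (axis k 1) * v $ k)"
          by (simp add: q.G_sum mult.commute)
        moreover have "(\<Sum>k\<in>UNIV. v $ k *\<^sub>R axis k 1) = v"
          using basis_expansion[of v] by (simp add: scalar_mult_eq_scaleR)
        ultimately show ?thesis by simp
      qed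
      have "(\<Sum>k\<in>UNIV. first_form x (axis i 1) (axis k 1) * W k j)
        = first_form x (axis i 1) w1 * w1 $ j + first_form x (axis i 1) w2 * w2 $ j + first_form x (axis i 1) w3 * w3 $ j"
        unfolding s[symmetric, of "axis i 1" w1] s[symmetric, of "axis i 1" w2] s[symmetric, of "axis i 1" w3] sum_distrib_right W_def
        by (simp only: distrib_left sum.distrib mult.assoc)
      also have "\<dots> = (axis i 1 :: real ^ 'k) $ j"
        by (subst expand[of "axis i 1"]) simp
      finally show ?thesis by (simp add: axis_def)
    qed
    then show "(\<chi> i j. first_form x (axis i 1) (axis j 1)) ** (\<chi> i j. W i j) = mat 1"
      by (simp add: matrix_matrix_mult_def mat_def vec_eq_iff)
  qed
  have PP: "(\<Sum>i\<in>UNIV. \<Sum>j\<in>UNIV. (v $ i * v $ j) *\<^sub>R P x (axis i 1) (axis j 1)) = P x v v" for v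
  proof -
    have v: "(\<Sum>k\<in>UNIV. v $ k *\<^sub>R axis k 1) = v"
      using basis_expansion[of v] by (simp add: scalar_mult_eq_scaleR)
    have "P x v v = P x (\<Sum>i\<in>UNIV. v $ i *\<^sub>R axis i 1) (\<Sum>j\<in>UNIV. v $ j *\<^sub>R axis j 1)"
      by (simp add: v)
    also have "\<dots> = (\<Sum>j\<in>UNIV. \<Sum>i\<in>UNIV. (v $ j * v $ i) *\<^sub>R P x (axis i 1) (axis j 1))"
      by (simp add: linear_sum[OF P_linear(1)[OF x]] linear_sum[OF P_linear(2)[OF x]]
          linear_cmul[OF P_linear(1)[OF x]] linear_cmul[OF P_linear(2)[OF x]] scaleR_sum_right)
    also have "\<dots> = (\<Sum>i\<in>UNIV. \<Sum>j\<in>UNIV. (v $ i * v $ j) *\<^sub>R P x (axis i 1) (axis j 1))"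
      by (subst sum.swap) (simp add: mult.commute)
    finally show ?thesis by simp
  qed
  define H where "H = P x w1 w1 + P x w2 w2 + P x w3 w3"
  have "(\<Sum>i\<in>UNIV. \<Sum>j\<in>UNIV. W i j *\<^sub>R P x (axis i 1) (axis j 1)) = H"
    unfolding H_def PP[symmetric] W_def by (simp add: scaleR_add_left sum.distrib)
  then have "(\<Sum>i\<in>UNIV. \<Sum>j\<in>UNIV. W i j *\<^sub>R nrm (P x (axis i 1) (axis j 1))) = nrm H"
    by (auto simp: linear_sum[OF nrm_lin] linear_cmul[OF nrm_lin])
  \<comment> \<open>The cyclic rotations of the basis supply the three normal components in
    turn.\<close>
  moreover have "nrm H = 0"
    using trace_P_normal[OF x w] trace_P_normal[OF x w'] trace_P_normal[OF x w'']
    by (simp add: nrm_def H_def e add.assoc) (simp add: algebra_simps)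
  ultimately show ?thesis by (simp add: inv np)
qed

section \<open>The volume form induced on the patch\<close>

lemma vol_alternating:
  assumes x: "x \<in> U"
  shows "linear (\<lambda>u. vol x u v w)" "linear (\<lambda>v. vol x u v w)" "linear (\<lambda>w. vol x u v w)"
    "vol x u v w = - vol x v u w" "vol x u v w = - vol x u w v"
proof -
  interpret nk_tensors "g (f x)" "J (f x)" "N (f x)" by (rule nk_tensors_f[OF x])
  note l = linear_add[OF df_linear[OF x]] linear_cmul[OF df_linear[OF x]]
  show "linear (\<lambda>u. vol x u v w)" "linear (\<lambda>v. vol x u v w)" "linear (\<lambda>w. vol x u v w)"
    unfolding vol_def by (rule linearI; simp add: l)+
  \<comment> \<open>Skewness in the last two slots holds because the \<open>J\<close> in the third
    argument may be moved to the second.\<close>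
  show "vol x u v w = - vol x v u w" "vol x u v w = - vol x u w v"
    using T_skew(1)[of "der f x u" "der f x v" "J (f x) (der f x w)"]
      T_skew(2)[of "der f x u" "der f x v" "J (f x) (der f x w)"] T_J(2)[of "der f x u" "der f x w" "der f x v"]
    by (simp_all add: vol_def T_def)
qed

text \<open>Otherwise the value on an orthonormal basis, a determinant times this one, would vanish
  as well.\<close>

lemma vol_nonzero:
  assumes x: "x \<in> U" and k: "(UNIV :: 'k set) = {k1, k2, k3}" "k1 \<noteq> k2" "k1 \<noteq> k3" "k2 \<noteq> k3"
  shows "vol x (axis k1 1) (axis k2 1) (axis k3 1) \<noteq> 0"
proof
  assume 0: "vol x (axis k1 1) (axis k2 1) (axis k3 1) = 0"
  obtain w1 w2 w3 where w: "onb x w1 w2 w3" using onb_exists[OF x] .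
  define L where "L = (\<lambda>v :: real ^ 'k. v $ k1 *\<^sub>R w1 + v $ k2 *\<^sub>R w2 + v $ k3 *\<^sub>R w3)"
  have "L (axis k1 1) = w1" "L (axis k2 1) = w2" "L (axis k3 1) = w3"
    using k(2-4) by (auto simp: L_def axis_def)
  then have "vol x w1 w2 w3 = 0"
    using alternating_3_det[OF k vol_alternating[OF x], of L] 0 by simp
  then show False using vol_onb[OF x w] by simp
qed

lemma vol_continuous: "continuous_on U (\<lambda>x. vol x u v w)"
proof (rule continuous_at_imp_continuous_on, intro ballI)
  fix x assume x: "x \<in> U"
  note fx = f_S[OF x] f_diff(1)[OF x] refl
  have "(\<lambda>x. vol x u v w) differentiable (at x)"
    unfolding vol_def by (intro along_g(1)[OF fx] along_N(1)[OF fx] along_J(1)[OF fx] f_diff x)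
  then show "isCont (\<lambda>x. vol x u v w) x" by (rule differentiable_imp_continuous_within)
qed

end

section \<open>Charts and orientation\<close>

lemma chart_props:
  assumes c: "is_chart X c"
  shows chart_openin: "openin X (fst c)" and chart_open_image: "open (chart_image c)"
    and chart_inj: "inj_on (snd c) (fst c)" and topspace_chart: "topspace (subtopology X (fst c)) = fst c"
proof -
  show o: "openin X (fst c)" "open (chart_image c)" using c by (auto simp: is_chart_def)
  show t: "topspace (subtopology X (fst c)) = fst c"
    using openin_subset[OF o(1)] by auto
  show "inj_on (snd c) (fst c)"
    using c t homeomorphic_imp_injective_map unfolding is_chart_def by metis
qed

lemma chart_inv_snd: "is_chart X c \<Longrightarrow> p \<in> fst c \<Longrightarrow> chart_inv c (snd c p) = p"
  by (simp add: chart_inj inv_into_f_f)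

lemma chart_image_openin:
  assumes c: "is_chart X c" and W: "openin X W" "W \<subseteq> fst c"
  shows "open (snd c ` W)"
proof -
  have "openin (subtopology X (fst c)) W"
    using W chart_openin[OF c] by (simp add: openin_open_subtopology)
  then have "openin (top_of_set (chart_image c)) (snd c ` W)"
    using c homeomorphic_imp_open_map unfolding is_chart_def open_map_def by blast
  then show ?thesis using chart_open_image[OF c] openin_open_trans by blast
qed

lemma chart_preimage_openin:
  assumes c: "is_chart X c" and Y: "open Y"
  shows "openin X (fst c \<inter> snd c -` Y)"
proof -
  have "continuous_map (subtopology X (fst c)) (top_of_set (chart_image c)) (snd c)"
    using c homeomorphic_imp_continuous_map unfolding is_chart_def by blast
  moreover have "openin (top_of_set (chart_image c)) (chart_image c \<inter> Y)"
    using Y by (simp add: openin_open_Int)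
  ultimately have "openin (subtopology X (fst c))
      {p \<in> topspace (subtopology X (fst c)). snd c p \<in> chart_image c \<inter> Y}"
    by (rule openin_continuous_map_preimage)
  moreover have "{p \<in> topspace (subtopology X (fst c)). snd c p \<in> chart_image c \<inter> Y} = fst c \<inter> snd c -` Y"
    using topspace_chart[OF c] by auto
  ultimately show ?thesis using chart_openin[OF c] by (simp add: openin_open_subtopology)
qed

lemma overlap_eq: "overlap c d = snd c ` (fst c \<inter> fst d)"
  by (auto simp: local_dom_def)

lemma open_overlap: "is_chart X c \<Longrightarrow> is_chart X d \<Longrightarrow> open (overlap c d)"
  unfolding overlap_eq by (rule chart_image_openin) (auto simp: chart_openin)

lemma transition_differentiable:
  assumes "smooth_atlas X A" "c \<in> A" "d \<in> A" "x \<in> overlap c d"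
  shows "transition c d differentiable (at x)"
proof (rule smooth_on_differentiable)
  show "smooth_on (overlap c d) (transition c d)"
    using assms(1-3) unfolding smooth_atlas_def by blast
qed fact

lemma local_rep_snd: "is_chart X d \<Longrightarrow> p \<in> fst d \<Longrightarrow> local_rep d c F (snd d p) = snd c (F p)"
  by (simp add: local_rep_def chart_inv_snd)

lemma open_local_dom:
  assumes "is_chart L d" "is_chart M c" "continuous_map L M F"
  shows "open (local_dom d c F)"
proof -
  have "openin L {p \<in> topspace L. F p \<in> fst c}"
    by (rule openin_continuous_map_preimage[OF assms(3) chart_openin[OF assms(2)]])
  then have "openin L (fst d \<inter> {p \<in> topspace L. F p \<in> fst c})"
    using chart_openin[OF assms(1)] by blast
  moreover have "fst d \<inter> {p \<in> topspace L. F p \<in> fst c} = fst d \<inter> F -` fst c"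
    using openin_subset[OF chart_openin[OF assms(1)]] by auto
  ultimately show ?thesis
    unfolding local_dom_def by (intro chart_image_openin[OF assms(1)]) auto
qed

section \<open>Charts modified by a sign\<close>

text \<open>The chart \<open>d\<close> restricted to \<open>W\<close> and multiplied by \<open>e = \<plusminus>1\<close>. As \<open>L\<close> has odd dimension,
  \<open>e = -1\<close> reverses the orientation.\<close>

definition signed_chart :: "('l, 'k::finite) chart \<Rightarrow> real \<Rightarrow> 'l set \<Rightarrow> ('l, 'k) chart" where
  "signed_chart d e W = (W, \<lambda>p. e *\<^sub>R snd d p)"

lemma signed_chart_simps [simp]: "fst (signed_chart d e W) = W" "snd (signed_chart d e W) p = e *\<^sub>R snd d p"
  by (simp_all add: signed_chart_def)

lemma signed_chart_self: "signed_chart d 1 (fst d) = d"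
  by (simp add: signed_chart_def)

lemma is_chart_signed_chart:
  assumes d: "is_chart L d" and W: "openin L W" "W \<subseteq> fst d" and e: "e = 1 \<or> e = - 1"
  shows "is_chart L (signed_chart d e W)"
proof -
  have ee: "e * e = 1" using e by auto
  have "homeomorphic_map (subtopology (subtopology L (fst d)) W)
      (subtopology (top_of_set (chart_image d)) (snd d ` W)) (snd d)"
  proof (rule homeomorphic_map_subtopologies)
    show "homeomorphic_map (subtopology L (fst d)) (top_of_set (chart_image d)) (snd d)"
      using d by (simp add: is_chart_def)
    show "snd d ` (topspace (subtopology L (fst d)) \<inter> W) = topspace (top_of_set (chart_image d)) \<inter> snd d ` W"
      using W topspace_chart[OF d] by auto
  qed
  moreover have "subtopology (subtopology L (fst d)) W = subtopology L W"
    using W by (simp add: subtopology_subtopology Int_absorb1)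
  moreover have "subtopology (top_of_set (chart_image d)) (snd d ` W) = top_of_set (snd d ` W)"
    using W by (simp add: subtopology_subtopology Int_absorb1 image_mono)
  ultimately have 1: "homeomorphic_map (subtopology L W) (top_of_set (snd d ` W)) (snd d)" by simp
  have "homeomorphic_maps (top_of_set (snd d ` W)) (top_of_set ((*\<^sub>R) e ` snd d ` W)) ((*\<^sub>R) e) ((*\<^sub>R) e)"
    unfolding homeomorphic_maps_def
    by (auto simp: ee intro!: continuous_intros)
  then have 2: "homeomorphic_map (subtopology L W) (top_of_set ((*\<^sub>R) e ` snd d ` W)) ((*\<^sub>R) e \<circ> snd d)"
    using homeomorphic_map_compose[OF 1] homeomorphic_maps_imp_map by blast
  have im: "chart_image (signed_chart d e W) = (*\<^sub>R) e ` snd d ` W"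
    by (auto simp: signed_chart_def)
  have "open ((*\<^sub>R) e ` snd d ` W)"
    using open_scaling[OF _ chart_image_openin[OF d W], of e] e by auto
  moreover have "(*\<^sub>R) e \<circ> snd d = snd (signed_chart d e W)" by (auto simp: signed_chart_def)
  ultimately show ?thesis
    using 2 W im unfolding is_chart_def by simp
qed

lemma transition_signed_chart:
  assumes d: "is_chart L d" "is_chart L d'" and W: "openin L W" "W \<subseteq> fst d" "openin L W'" "W' \<subseteq> fst d'"
    and e: "e = 1 \<or> e = - 1" "e' = 1 \<or> e' = - 1"
  defines "c \<equiv> signed_chart d e W" and "c' \<equiv> signed_chart d' e' W'"
  shows "y \<in> overlap c c' \<Longrightarrow> e *\<^sub>R y \<in> overlap d d'"
    and "y \<in> overlap c c' \<Longrightarrow> transition c c' y = e' *\<^sub>R transition d d' (e *\<^sub>R y)"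
proof -
  have ee: "e * e = 1" using e by auto
  assume "y \<in> overlap c c'"
  then obtain p where p: "p \<in> W" "p \<in> W'" "y = e *\<^sub>R snd d p"
    by (auto simp: overlap_eq c_def c'_def)
  then have ey: "e *\<^sub>R y = snd d p" by (simp add: ee)
  then show "e *\<^sub>R y \<in> overlap d d'" using p W by (auto simp: overlap_eq)
  have c: "is_chart L c" unfolding c_def by (rule is_chart_signed_chart) fact+
  have "transition c c' (snd c p) = snd c' p"
    using local_rep_snd[OF c, of p c' "\<lambda>p. p"] p by (simp add: c_def)
  moreover have "transition d d' (snd d p) = snd d' p"
    using local_rep_snd[OF d(1), of p d' "\<lambda>p. p"] p W by auto
  ultimately show "transition c c' y = e' *\<^sub>R transition d d' (e *\<^sub>R y)"
    unfolding ey using p by (simp add: c_def c'_def)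
qed

text \<open>A chart of \<open>B\<close> is itself a signed chart, with sign 1 and full domain. Hence
  the same lemma shows that the oriented charts form an atlas and that they are compatible with
  \<open>B\<close>.\<close>

lemma smooth_atlas_signed_charts:
  assumes B: "smooth_atlas L B"
    and C: "\<And>c. c \<in> C \<Longrightarrow> \<exists>d\<in>B. \<exists>e W. c = signed_chart d e W \<and> (e = 1 \<or> e = - 1) \<and> openin L W \<and> W \<subseteq> fst d"
    and cover: "topspace L \<subseteq> (\<Union>c\<in>C. fst c)"
  shows "smooth_atlas L C"
proof -
  have Bc: "is_chart L d" if "d \<in> B" for d using B that by (simp add: smooth_atlas_def)
  have chart: "is_chart L c" if "c \<in> C" for c
    using C[OF that] is_chart_signed_chart Bc by blast
  have "smooth_on (overlap c c') (transition c c')" if cc: "c \<in> C" "c' \<in> C" for c c'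
  proof -
    obtain d e W where d: "d \<in> B" "c = signed_chart d e W" "e = 1 \<or> e = - 1" "openin L W" "W \<subseteq> fst d"
      using C[OF cc(1)] by blast
    obtain d' e' W' where d': "d' \<in> B" "c' = signed_chart d' e' W'" "e' = 1 \<or> e' = - 1" "openin L W'" "W' \<subseteq> fst d'"
      using C[OF cc(2)] by blast
    note t = transition_signed_chart[OF Bc[OF d(1)] Bc[OF d'(1)] d(4,5) d'(4,5) d(3) d'(3), folded d(2) d'(2)]
    have o: "open (overlap c c')" by (rule open_overlap[OF chart[OF cc(1)] chart[OF cc(2)]])
    have "Ck_on k (overlap c c') (transition c c')" for k
    proof (rule Ck_on_cong[OF o])
      have "Ck_on k (overlap d d') (transition d d')"
        using B d(1) d'(1) by (simp add: smooth_atlas_def smooth_on_def)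
      then show "Ck_on k (overlap c c') (\<lambda>y. e' *\<^sub>R transition d d' (e *\<^sub>R y))"
        using o t(1) by (rule Ck_on_scale)
    qed (simp add: t(2))
    then show ?thesis by (simp add: smooth_on_def)
  qed
  moreover have "(\<Union>c\<in>C. fst c) \<subseteq> topspace L"
    using chart_openin[OF chart] openin_subset by blast
  ultimately show ?thesis
    using chart cover unfolding smooth_atlas_def by blast
qed

lemma nk_chart_of_nearly_kaehler:
  fixes A :: "('m, 'n::finite) chart set"
  assumes nk: "nearly_kaehler A J g \<Gamma>" and atlas: "smooth_atlas M A" and c: "c \<in> A"
  shows "nk_chart (chart_image c) (g c) (J c) (\<Gamma> c)"
proof -
  have ah: "almost_hermitian A J g" and lc: "levi_civita A g \<Gamma>"
    and nk0: "\<And>x v. x \<in> chart_image c \<Longrightarrow> cov_J \<Gamma> J c x v v = 0"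
    using nk c by (auto simp: nearly_kaehler_def)
  have rm: "riemannian_metric A g" and ac: "almost_complex_structure A J"
    and gJ: "\<And>x v w. x \<in> chart_image c \<Longrightarrow> g c x (J c x v) (J c x w) = g c x v w"
    using ah c by (auto simp: almost_hermitian_def)
  have af: "affine_connection A \<Gamma>" and tf: "torsion_free A \<Gamma>" and mc: "metric_connection A g \<Gamma>"
    using lc by (auto simp: levi_civita_def)
  have const: "smooth_on (chart_image c) (\<lambda>x. v)" for v :: "real ^ 'n" by (rule smooth_on_const)
  show ?thesis
  proof (rule nk_chart.intro)
    show "open (chart_image c)"
      using atlas c by (intro chart_open_image[of M]) (simp add: smooth_atlas_def)
    show "smooth_on (chart_image c) (\<lambda>x. g c x v w)" for v w using rm c by (simp add: riemannian_metric_def)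
    show "smooth_on (chart_image c) (\<lambda>x. J c x v)" for v using ac c by (simp add: almost_complex_structure_def)
    show "smooth_on (chart_image c) (\<lambda>x. \<Gamma> c x v w)" for v w using af c by (simp add: affine_connection_def)
    fix x assume x: "x \<in> chart_image c"
    show "hermitian_form (g c x) (J c x)"
      using rm ac gJ[OF x] c x unfolding riemannian_metric_def almost_complex_structure_def
      by (intro hermitian_form.intro inner_form.intro hermitian_form_axioms.intro) blast+
    show "bilinear (\<Gamma> c x)" using af c x unfolding affine_connection_def by blast
    show "\<Gamma> c x v w = \<Gamma> c x w v" for v w
    proof -
      have "cov (\<Gamma> c) x v (\<lambda>y. w) - cov (\<Gamma> c) x w (\<lambda>y. v) = lie_bracket (\<lambda>y. v) (\<lambda>y. w) x"
        using tf c x const[of v] const[of w] unfolding torsion_free_def by blast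
      then show ?thesis by (simp add: cov_def lie_bracket_def)
    qed
    show "der (\<lambda>y. g c y v w) x u = g c x (\<Gamma> c x u v) w + g c x v (\<Gamma> c x u w)" for u v w
    proof -
      have "der (\<lambda>y. g c y v w) x u = g c x (cov (\<Gamma> c) x u (\<lambda>y. v)) w + g c x v (cov (\<Gamma> c) x u (\<lambda>y. w))"
        using mc c x const[of v] const[of w] unfolding metric_connection_def by blast
      then show ?thesis by (simp add: cov_def)
    qed
    show "der (\<lambda>y. J c y v) x v + \<Gamma> c x v (J c x v) - J c x (\<Gamma> c x v v) = 0" for v
      using nk0[OF x, of v] by (simp add: cov_J_def cov_def)
  qed
qed

lemma cov_J_eq_N:
  "nk_chart S gc (J c) (\<Gamma> c) \<Longrightarrow> cov_J \<Gamma> J c x v w = nk_chart.N (J c) (\<Gamma> c) x v w"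
  by (simp add: nk_chart.N_def cov_J_def cov_def)

text \<open>Differentiate the transformation law of \<open>J\<close>. The second derivatives of the
  transition map cancel against the inhomogeneous term in the change-of-chart rule for
  \<open>\<Gamma>\<close>.\<close>

lemma cov_J_transition:
  fixes A :: "('m, 'n::finite) chart set"
  assumes nk: "nearly_kaehler A J g \<Gamma>" and atlas: "smooth_atlas M A" and c: "c \<in> A" "d \<in> A"
    and x: "x \<in> overlap c d"
  defines "\<psi> \<equiv> transition c d"
  shows "cov_J \<Gamma> J d (\<psi> x) (der \<psi> x v) (der \<psi> x w) = der \<psi> x (cov_J \<Gamma> J c x v w)"
proof -
  interpret c: nk_chart "chart_image c" "g c" "J c" "\<Gamma> c" by (rule nk_chart_of_nearly_kaehler[OF nk atlas c(1)])
  interpret d: nk_chart "chart_image d" "g d" "J d" "\<Gamma> d" by (rule nk_chart_of_nearly_kaehler[OF nk atlas c(2)])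
  have ch: "is_chart M c" "is_chart M d" using atlas c by (auto simp: smooth_atlas_def)
  have o: "open (overlap c d)" by (rule open_overlap[OF ch])
  have sm: "smooth_on (overlap c d) \<psi>" using atlas c by (simp add: smooth_atlas_def \<psi>_def)
  have df: "\<psi> differentiable (at y)" "(\<lambda>y. der \<psi> y u) differentiable (at y)" if "y \<in> overlap c d" for y u
    using smooth_on_differentiable smooth_on_der sm that by blast+
  have xc: "x \<in> chart_image c" using x by (auto simp: local_dom_def)
  have xd: "\<psi> x \<in> chart_image d"
    using x ch local_rep_snd[OF ch(1), of _ d "\<lambda>p. p"] by (auto simp: local_dom_def \<psi>_def)
  have J: "J d (\<psi> y) (der \<psi> y u) = der \<psi> y (J c y u)" if "y \<in> overlap c d" for y u
    using nk c that by (simp add: nearly_kaehler_def almost_hermitian_def almost_complex_structure_def \<psi>_def)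
  have G: "der \<psi> x (\<Gamma> c x u u') = der (\<lambda>y. der \<psi> y u') x u + \<Gamma> d (\<psi> x) (der \<psi> x u) (der \<psi> x u')" for u u'
    using nk c x by (simp add: nearly_kaehler_def levi_civita_def affine_connection_def \<psi>_def)
  have dJ: "(\<lambda>y. J c y w) differentiable (at x)" by (rule smooth_on_differentiable[OF c.J_smooth xc])
  have "der (\<lambda>y. J d (\<psi> y) (der \<psi> y w)) x v = der (\<lambda>y. der \<psi> y (J c y w)) x v"
    by (rule fun_cong[OF der_cong_open[OF o x J]])
  moreover have "der (\<lambda>y. J d (\<psi> y) (der \<psi> y w)) x v =
      der (\<lambda>y. J d y (der \<psi> x w)) (\<psi> x) (der \<psi> x v) + J d (\<psi> x) (der (\<lambda>y. der \<psi> y w) x v)"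
    by (simp add: der_eqI[OF d.der_J[OF xd df(1)[OF x] refl df(2)[OF x]]])
  moreover have "der (\<lambda>y. der \<psi> y (J c y w)) x v =
      der (\<lambda>y. der \<psi> y (J c x w)) x v + der \<psi> x (der (\<lambda>y. J c y w) x v)"
    using der_eqI[OF has_derivative_linear_family_along[OF o, of "\<lambda>y. y" x "der \<psi>" "\<lambda>y. J c y w"]]
      x dJ df linear_der[OF df(1)] by simp
  moreover have l: "linear (der \<psi> x)" by (rule linear_der[OF df(1)[OF x]])
  moreover have "linear (J d (\<psi> x))" by (rule d.J_lin[OF xd])
  ultimately show ?thesis
    unfolding cov_J_def cov_def
    by (simp add: linear_add linear_diff J[OF x, symmetric] G)
       (simp add: J[OF x] algebra_simps)
qed

section \<open>Globalization: minimality and orientation\<close>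

locale lagrangian_submanifold =
  fixes M :: "'m topology" and A :: "('m, 'n::finite) chart set"
    and J :: "('m, 'n) endomorphism_field" and g :: "('m, 'n) metric_tensor"
    and \<Gamma> :: "('m, 'n) connection"
    and L :: "'l topology" and B :: "('l, 'k::finite) chart set"
    and F :: "'l \<Rightarrow> 'm"
  assumes M: "smooth_manifold M A" and dim_n: "CARD('n) = 6"
    and snk: "strict_nearly_kaehler A J g \<Gamma>"
    and L: "smooth_manifold L B" and lag: "lagrangian L B M A J g F"
begin

lemma nk: "nearly_kaehler A J g \<Gamma>"
  using snk by (simp add: strict_nearly_kaehler_def)

lemma atlas: "smooth_atlas M A" "smooth_atlas L B"
  using M L by (simp_all add: smooth_manifold_def)

lemma charts: "c \<in> A \<Longrightarrow> is_chart M c" "d \<in> B \<Longrightarrow> is_chart L d"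
  using atlas by (simp_all add: smooth_atlas_def)

lemma F_cont: "continuous_map L M F"
  and F_smooth: "d \<in> B \<Longrightarrow> c \<in> A \<Longrightarrow> smooth_on (local_dom d c F) (local_rep d c F)"
  using lag by (auto simp: lagrangian_def immersion_def smooth_map_def)

lemma dim_k: "CARD('k) = 3"
  using lag dim_n by (simp add: lagrangian_def)

lemma patch:
  assumes d: "d \<in> B" and c: "c \<in> A"
  shows "lagrangian_patch (chart_image c) (g c) (J c) (\<Gamma> c) (local_dom d c F) (local_rep d c F)"
proof -
  interpret nk_chart "chart_image c" "g c" "J c" "\<Gamma> c"
    by (rule nk_chart_of_nearly_kaehler[OF nk atlas(1) c])
  show ?thesis
  proof
    show "open (local_dom d c F)" by (rule open_local_dom[OF charts(2)[OF d] charts(1)[OF c] F_cont])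
    show "smooth_on (local_dom d c F) (local_rep d c F)" by (rule F_smooth[OF d c])
    show "CARD('n) = 6" "CARD('k) = 3" by (rule dim_n dim_k)+
    show "\<exists>z'. N y z z' \<noteq> 0" if "y \<in> chart_image c" "z \<noteq> 0" for y z
    proof -
      have "\<exists>w. cov_J \<Gamma> J c y z w \<noteq> 0"
        using snk c that unfolding strict_nearly_kaehler_def by blast
      then show ?thesis by (simp add: cov_J_eq_N[of _ _ J c \<Gamma>, OF nk_chart_axioms])
    qed
    fix x assume x: "x \<in> local_dom d c F"
    show "local_rep d c F x \<in> chart_image c"
    proof -
      obtain p where "p \<in> fst d" "F p \<in> fst c" "x = snd d p"
        using x by (auto simp: local_dom_def)
      then show ?thesis by (simp add: local_rep_snd[OF charts(2)[OF d]])
    qed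
    show "inj (der (local_rep d c F) x)"
      using lag d c x by (simp add: lagrangian_def immersion_def)
    show "g c (local_rep d c F x) (J c (local_rep d c F x) (der (local_rep d c F) x u)) (der (local_rep d c F) x v) = 0"
      for u v using lag d c x by (simp add: lagrangian_def characteristic_form_def)
  qed
qed

lemma minimal: "minimal B A g \<Gamma> F"
  unfolding minimal_def
proof (intro ballI)
  fix d c x assume d: "d \<in> B" and c: "c \<in> A" and x: "x \<in> local_dom d c F"
  interpret p: lagrangian_patch "chart_image c" "g c" "J c" "\<Gamma> c" "local_dom d c F" "local_rep d c F"
    by (rule patch[OF d c])
  show "mean_curvature g \<Gamma> F d c x = 0"
    using p.mean_curvature_0[OF x]
    unfolding mean_curvature_def second_fundamental_form_def induced_gram_def Let_def
      p.first_form_def p.P_def by simp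
qed

definition vol where
  "vol d c x u v w = lagrangian_patch.vol (g c) (J c) (\<Gamma> c) (local_rep d c F) x u v w"

text \<open>Covers a simultaneous change of chart on \<open>L\<close> and on \<open>M\<close>, so
  that signs found in different ambient charts can be compared.\<close>

lemma vol_transition:
  assumes d: "d \<in> B" "d' \<in> B" and c: "c \<in> A" "c' \<in> A"
    and p: "p \<in> fst d" "p \<in> fst d'" "F p \<in> fst c" "F p \<in> fst c'"
  defines "\<phi> \<equiv> transition d d'"
  shows "vol d c (snd d p) u v w =
    vol d' c' (snd d' p) (der \<phi> (snd d p) u) (der \<phi> (snd d p) v) (der \<phi> (snd d p) w)"
proof -
  let ?f = "local_rep d c F" and ?f' = "local_rep d' c' F"
  define \<psi> where "\<psi> = transition c c'"
  define x where "x = snd d p"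
  interpret P: lagrangian_patch "chart_image c" "g c" "J c" "\<Gamma> c" "local_dom d c F" ?f
    by (rule patch[OF d(1) c(1)])
  interpret P': lagrangian_patch "chart_image c'" "g c'" "J c'" "\<Gamma> c'" "local_dom d' c' F" ?f'
    by (rule patch[OF d(2) c(2)])
  note rep = local_rep_snd[OF charts(2)[OF d(1)]] local_rep_snd[OF charts(2)[OF d(2)]] local_rep_snd[OF charts(1)[OF c(1)]]
  have \<phi>x: "\<phi> x = snd d' p" using rep(1) p by (simp add: \<phi>_def x_def)
  have fx: "?f x = snd c (F p)" using rep(1) p by (simp add: x_def)
  have f'x: "?f' (\<phi> x) = snd c' (F p)" using rep(2) p by (simp add: \<phi>x)
  have \<psi>x: "\<psi> (?f x) = ?f' (\<phi> x)" using rep(3) p by (simp add: \<psi>_def fx f'x)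
  have xd: "x \<in> local_dom d c F" "\<phi> x \<in> local_dom d' c' F" "?f x \<in> overlap c c'" "x \<in> overlap d d'"
    using p unfolding \<phi>x fx local_dom_def by (auto simp: x_def)
  \<comment> \<open>A neighbourhood of \<open>p\<close> on which all four charts are available, so
    that the two expressions for the map can be differentiated and the chain rule compared.\<close>
  define W where "W = fst d \<inter> fst d' \<inter> {q \<in> topspace L. F q \<in> fst c \<inter> fst c'}"
  have "openin L W"
    unfolding W_def
    by (intro openin_Int[of L] openin_continuous_map_preimage[OF F_cont] openin_Int[of M])
      (rule chart_openin charts d c)+
  then have o: "open (snd d ` W)" by (intro chart_image_openin[OF charts(2)[OF d(1)]]) (auto simp: W_def)
  have xW: "x \<in> snd d ` W"
    using p openin_subset[OF chart_openin[OF charts(2)[OF d(1)]]] by (auto simp: W_def x_def)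
  have "?f' (\<phi> y) = \<psi> (?f y)" if "y \<in> snd d ` W" for y
    using that by (auto simp: W_def \<phi>_def \<psi>_def rep)
  then have "der (\<lambda>y. ?f' (\<phi> y)) x = der (\<lambda>y. \<psi> (?f y)) x"
    by (rule der_cong_open[OF o xW])
  moreover have d\<phi>: "\<phi> differentiable (at x)" and d\<psi>: "\<psi> differentiable (at (?f x))"
    unfolding \<phi>_def \<psi>_def
    by (rule transition_differentiable[OF atlas(2) d xd(4)] transition_differentiable[OF atlas(1) c xd(3)])+
  moreover have "der (\<lambda>y. ?f' (\<phi> y)) x = (\<lambda>u. der ?f' (\<phi> x) (der \<phi> x u))"
    by (intro der_eqI has_derivative_compose[OF der_works[OF d\<phi>]] der_works P'.f_diff xd)
  moreover have "der (\<lambda>y. \<psi> (?f y)) x = (\<lambda>u. der \<psi> (?f x) (der ?f x u))"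
    by (intro der_eqI has_derivative_compose[OF der_works[OF P.f_diff(1)[OF xd(1)]]] der_works d\<psi>)
  ultimately have chain: "der ?f' (\<phi> x) (der \<phi> x u) = der \<psi> (?f x) (der ?f x u)" for u
    by metis
  have N: "P'.N (\<psi> (?f x)) (der \<psi> (?f x) v) (der \<psi> (?f x) w) = der \<psi> (?f x) (P.N (?f x) v w)" for v w
    using cov_J_transition[OF nk atlas(1) c xd(3)]
      cov_J_eq_N[of _ _ J c \<Gamma>, OF P.nk_chart_axioms] cov_J_eq_N[of _ _ J c' \<Gamma>, OF P'.nk_chart_axioms] by (simp add: \<psi>_def)
  have J: "J c' (\<psi> (?f x)) (der \<psi> (?f x) v) = der \<psi> (?f x) (J c (?f x) v)" for v
    using nk c xd(3) by (simp add: nearly_kaehler_def almost_hermitian_def almost_complex_structure_def \<psi>_def)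
  have G: "g c' (\<psi> (?f x)) (der \<psi> (?f x) v) (der \<psi> (?f x) w) = g c (?f x) v w" for v w
    using nk c xd(3) by (simp add: nearly_kaehler_def almost_hermitian_def riemannian_metric_def \<psi>_def)
  show ?thesis
    by (simp add: vol_def P.vol_def P'.vol_def N J G chain flip: x_def \<phi>x \<psi>x)
qed

lemma orientable: "orientable L B"
proof -
  obtain k1 k2 k3 :: 'k where k: "(UNIV :: 'k set) = {k1, k2, k3}" "k1 \<noteq> k2" "k1 \<noteq> k3" "k2 \<noteq> k3"
    using dim_k unfolding card_3_iff by metis
  define \<sigma> where "\<sigma> d c x = vol d c x (axis k1 1) (axis k2 1) (axis k3 1)" for d c x
  \<comment> \<open>Since \<open>e\<close> cubed is \<open>e\<close>, the number
    \<open>e * \<sigma> d c\<close> is the value of the volume form on the coordinate basis of the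
    signed chart. The domain is small enough to be mapped into a single ambient chart.\<close>
  define C where "C = {signed_chart d e W | d e W. d \<in> B \<and> (e = 1 \<or> e = - 1) \<and> openin L W \<and> W \<subseteq> fst d \<and>
     (\<exists>c\<in>A. \<forall>p\<in>W. F p \<in> fst c \<and> e * \<sigma> d c (snd d p) > 0)}"
  have cover: "\<exists>c\<in>C. p \<in> fst c" if p: "p \<in> topspace L" for p
  proof -
    obtain d where d: "d \<in> B" "p \<in> fst d"
      using p atlas(2) unfolding smooth_atlas_def by blast
    have "F p \<in> topspace M" using F_cont p by (auto simp: continuous_map_def)
    then obtain c where c: "c \<in> A" "F p \<in> fst c"
      using atlas(1) unfolding smooth_atlas_def by blast
    interpret P: lagrangian_patch "chart_image c" "g c" "J c" "\<Gamma> c" "local_dom d c F" "local_rep d c F"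
      by (rule patch[OF d(1) c(1)])
    have xd: "snd d p \<in> local_dom d c F" using d c by (auto simp: local_dom_def)
    have "\<sigma> d c (snd d p) \<noteq> 0" using P.vol_nonzero[OF xd k] by (simp add: \<sigma>_def vol_def)
    then obtain e :: real where e: "e = 1 \<or> e = - 1" "e * \<sigma> d c (snd d p) > 0"
      by (metis linorder_neqE_linordered_idom mult_1 mult_minus1 neg_0_less_iff_less)
    have "continuous_on (local_dom d c F) (\<lambda>x. e * \<sigma> d c x)"
      unfolding \<sigma>_def vol_def by (intro continuous_intros P.vol_continuous)
    then have "open ((\<lambda>x. e * \<sigma> d c x) -` {0<..} \<inter> local_dom d c F)"
      using P.open_U by (intro continuous_on_open_vimage[THEN iffD1, rule_format]) auto
    \<comment> \<open>By continuity the sign chosen at \<open>p\<close> remains correct on a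
      neighbourhood.\<close>
    then have "openin L (fst d \<inter> snd d -` ((\<lambda>x. e * \<sigma> d c x) -` {0<..} \<inter> local_dom d c F))" (is "openin L ?W")
      by (rule chart_preimage_openin[OF charts(2)[OF d(1)]])
    moreover have "F q \<in> fst c \<and> e * \<sigma> d c (snd d q) > 0" if "q \<in> ?W" for q
      using that chart_inv_snd[OF charts(2)[OF d(1)]] by (auto simp: local_dom_def) (metis)
    ultimately have "signed_chart d e ?W \<in> C"
      unfolding C_def using d(1) e(1) c(1) by blast
    moreover have "p \<in> fst (signed_chart d e ?W)" using d(2) xd e(2) by simp
    ultimately show ?thesis by blast
  qed
  have C: "\<exists>d\<in>B. \<exists>e W. c = signed_chart d e W \<and> (e = 1 \<or> e = - 1) \<and> openin L W \<and> W \<subseteq> fst d" if "c \<in> C" for c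
    using that unfolding C_def by blast
  have B: "\<exists>d\<in>B. \<exists>e W. c = signed_chart d e W \<and> (e = 1 \<or> e = - 1) \<and> openin L W \<and> W \<subseteq> fst d" if "c \<in> B" for c
    using that signed_chart_self[of c] chart_openin[OF charts(2)] by (metis order_refl)
  have "smooth_atlas L C"
    by (rule smooth_atlas_signed_charts[OF atlas(2) C]) (use cover in auto)
  moreover have "smooth_atlas L (B \<union> C)"
    by (rule smooth_atlas_signed_charts[OF atlas(2)]) (use cover B C in auto)
  moreover have "det (matrix (der (transition a b) y)) > 0" if a: "a \<in> C" and b: "b \<in> C" and y: "y \<in> overlap a b" for a b y
  proof -
    obtain d e W c where d: "a = signed_chart d e W" "d \<in> B" "e = 1 \<or> e = - 1" "openin L W" "W \<subseteq> fst d"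
      and c: "c \<in> A" "\<And>p. p \<in> W \<Longrightarrow> F p \<in> fst c \<and> e * \<sigma> d c (snd d p) > 0"
      using a unfolding C_def by blast
    obtain d' e' W' c' where d': "b = signed_chart d' e' W'" "d' \<in> B" "e' = 1 \<or> e' = - 1" "openin L W'" "W' \<subseteq> fst d'"
      and c': "c' \<in> A" "\<And>p. p \<in> W' \<Longrightarrow> F p \<in> fst c' \<and> e' * \<sigma> d' c' (snd d' p) > 0"
      using b unfolding C_def by blast
    obtain p where p: "p \<in> W" "p \<in> W'" "y = e *\<^sub>R snd d p"
      using y by (auto simp: overlap_eq d d')
    have ee: "e * e = 1" "e' * e' = 1" using d d' by auto
    then have ey: "e *\<^sub>R y = snd d p" by (simp add: p)
    have pd: "p \<in> fst d" "p \<in> fst d'" "F p \<in> fst c" "F p \<in> fst c'" using p d d' c c' by auto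
    let ?\<phi> = "transition d d'" and ?x' = "snd d' p"
    define \<Phi> where "\<Phi> = der ?\<phi> (snd d p)"
    have df: "?\<phi> differentiable (at (e *\<^sub>R y))"
      using transition_differentiable[OF atlas(2) d(2) d'(2), of "snd d p"] pd by (auto simp: ey overlap_eq)
    note t = transition_signed_chart[OF charts(2)[OF d(2)] charts(2)[OF d'(2)] d(4,5) d'(4,5) d(3) d'(3), folded d(1) d'(1)]
    have "is_chart L a" "is_chart L b"
      using is_chart_signed_chart[OF charts(2)[OF d(2)] d(4,5,3)]
        is_chart_signed_chart[OF charts(2)[OF d'(2)] d'(4,5,3)] d(1) d'(1) by simp_all
    then have o: "open (overlap a b)" by (rule open_overlap)
    have D: "der (transition a b) y = (\<lambda>v. (e' * e) *\<^sub>R \<Phi> v)"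
    proof
      fix v
      have "der (transition a b) y = der (\<lambda>y. e' *\<^sub>R ?\<phi> (e *\<^sub>R y)) y"
        by (rule der_cong_open[OF o y t(2)])
      then show "der (transition a b) y v = (e' * e) *\<^sub>R \<Phi> v"
        by (simp add: der_scale(2)[OF df] \<Phi>_def ey)
    qed
    interpret P: lagrangian_patch "chart_image c'" "g c'" "J c'" "\<Gamma> c'" "local_dom d' c' F" "local_rep d' c' F"
      by (rule patch[OF d'(2) c'(1)])
    have x': "?x' \<in> local_dom d' c' F" using pd by (auto simp: local_dom_def)
    note va = P.vol_alternating[OF x']
    have "P.vol ?x' ((e' * e) *\<^sub>R \<Phi> (axis k1 1)) ((e' * e) *\<^sub>R \<Phi> (axis k2 1)) ((e' * e) *\<^sub>R \<Phi> (axis k3 1))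
      = det (matrix (\<lambda>v. (e' * e) *\<^sub>R \<Phi> v)) * P.vol ?x' (axis k1 1) (axis k2 1) (axis k3 1)"
      by (rule alternating_3_det[OF k va])
    \<comment> \<open>Odd dimension enters here: the cube of \<open>e' * e\<close> is
      \<open>e' * e\<close>.\<close>
    moreover have "P.vol ?x' ((e' * e) *\<^sub>R u) ((e' * e) *\<^sub>R v) ((e' * e) *\<^sub>R w) = e' * e * P.vol ?x' u v w" for u v w
      using d(3) d'(3) linear_cmul[OF va(1)] linear_cmul[OF va(2)] linear_cmul[OF va(3)] by auto
    moreover have "P.vol ?x' (\<Phi> (axis k1 1)) (\<Phi> (axis k2 1)) (\<Phi> (axis k3 1)) = \<sigma> d c (snd d p)"
      using vol_transition[OF d(2) d'(2) c(1) c'(1) pd] by (simp add: \<sigma>_def vol_def \<Phi>_def)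
    ultimately have eq: "e' * e * \<sigma> d c (snd d p) = det (matrix (der (transition a b) y)) * \<sigma> d' c' ?x'"
      unfolding D by (simp add: \<sigma>_def vol_def)
    \<comment> \<open>The Jacobian determinant is the factor between two positive numbers, the
      normalised volumes in the charts \<open>a\<close> and \<open>b\<close>.\<close>
    have "e * \<sigma> d c (snd d p) = e' * (e' * e * \<sigma> d c (snd d p))"
      using ee by (simp flip: mult.assoc)
    also have "\<dots> = det (matrix (der (transition a b) y)) * (e' * \<sigma> d' c' ?x')"
      unfolding eq by simp
    finally have "det (matrix (der (transition a b) y)) * (e' * \<sigma> d' c' ?x') > 0"
      using c(2)[OF p(1)] by simp
    then show ?thesis by (rule zero_less_mult_pos2) (use c'(2)[OF p(2)] in simp)
  qed
  ultimately show ?thesis unfolding orientable_def by blast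
qed

end

theorem theoremA:
  fixes M :: "'m topology" and A :: "('m, 'n::finite) chart set"
    and J :: "('m, 'n) endomorphism_field" and g :: "('m, 'n) metric_tensor"
    and \<Gamma> :: "('m, 'n) connection"
    and L :: "'l topology" and B :: "('l, 'k::finite) chart set"
    and F :: "'l \<Rightarrow> 'm"
  assumes "smooth_manifold M A"
    and "CARD('n) = 6"
    and "strict_nearly_kaehler A J g \<Gamma>"
    and "smooth_manifold L B"
    and "lagrangian L B M A J g F"
  shows "orientable L B \<and> minimal B A g \<Gamma> F"
proof -
  interpret lagrangian_submanifold M A J g \<Gamma> L B F
    by (rule lagrangian_submanifold.intro) fact+
  show ?thesis using orientable minimal by blast
qed

end
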